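(* Let $f:\mathbb{R}^n\to\mathbb{R}$ be twice continuously differentiable, with $L_g$-Lipschitz continuous gradient and $L_H$-Lipschitz continuous Hessian on $\mathbb{R}^n$, and bounded below by a scalar $\bar f\in\mathbb{R}$. Let the Stochastic Two-Step Method (defined in the context) be run under the stochastic conditions (A), (B), (C) stated in the context, with parameters $\gamma\in(0,1]$, $\gamma_H\in[0,\gamma)$, $\gamma_\lambda\in[0,1)$, $\gamma_H<\gamma(1-\gamma_\lambda)$, $\delta\in(0,\infty)$, $\theta_k\in[0,1)$, $\hat\theta_k\in[0,\infty)$, and constant $\sigma_k=\sigma$ and $\hat\sigma_k=\hat\sigma>0$ for all $k$. Let the step sizes satisfy, for all $k$, $$0<\alpha_k\le\frac{1}{L_g(1+\hat\theta_k^2)}\qquad\text{and}\qquad 0<\beta_k\le\frac{3\left(\gamma-\frac{\gamma_H}{1-\gamma_\lambda}\right)}{2\delta L_H},$$ and $$\sum_{k=0}^\infty\alpha_k=\infty,\qquad\sum_{k=0}^\infty\alpha_k^2<\infty,\qquad\sum_{k=0}^\infty\beta_k<\infty.$$ Then the iterates generated by the method satisfy $$\liminf_{k\to\infty}\mathbb{E}[\|\nabla f(x_k)\|_2]=0.$$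
   Context: Setting: $f(x)=\mathbb{E}_\xi[F(x,\xi)]$ for a random variable $\xi$; only stochastic approximations of the gradient and Hessian are available. $\lambda_{\min}(A)$ denotes the left-most (smallest) eigenvalue of a symmetric matrix $A$. $\mathbb{N}=\{0,1,2,\dots\}$. Stochastic Two-Step Method. Given $x_0\in\mathbb{R}^n$ and step sizes $\alpha_k>0$, $\beta_k>0$, for $k=0,1,2,\dots$: 1. Compute a (symmetric, random) Hessian approximation $H_k$ of $\nabla^2 f(x_k)$, with left-most eigenvalue $\lambda_k$, such that condition (B) holds. If $\lambda_k\ge0$ set $p_k=0$; otherwise compute $q_k$ and set $p_k$ using condition (A). 2. Set $\hat x_k=x_k+\beta_kp_k$. 3. Compute a (random) gradient approximation $\hat g_k$ at $\hat x_k$ satisfying condition (C), and set $d_k=-\hat g_k$. 4. Set $x_{k+1}=\hat x_k+\alpha_kd_k=x_k+\beta_kp_k+\alpha_kd_k$. There is no termination test. Conditional expectations: $\mathcal{F}_k=\sigma(x_0,\dots,x_k)$, $\mathbb{E}_k[\cdot]=\mathbb{E}[\cdot\mid\mathcal{F}_k]$, $\mathbb{E}_{\hat k}[\cdot]=\mathbb{E}[\cdot\mid\mathcal{F}_k,\hat x_k]$, $\mathbb{E}_{k,q}[\cdot]=\mathbb{E}[\cdot\mid\mathcal{F}_k,q_k]$; $\mathbb{E}$ is the total expectation. Write $\lambda_k^-:=\min\{\lambda_k,0\}$ and $\lambda_{\min,k}^-:=\min\{\lambda_{\min}(\nabla^2 f(x_k)),0\}$. Conditions, required for all $k\in\mathbb{N}$,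 where in general $\theta_k\in[0,1)$ and $\hat\theta_k,\sigma_k,\hat\sigma_k\in[0,\infty)$: (A) If $\lambda_k\ge0$, then $p_k=0$ (and one takes $q_k=0$). Otherwise $p_k=q_k$ if $g_k^{\mathsf T}q_k\le0$ and $p_k=-q_k$ otherwise, where $q_k$ satisfies $q_k^{\mathsf T}H_kq_k\le\gamma\lambda_k\|q_k\|_2^2<0$ and $\|q_k\|_2=\delta|\lambda_k|$. The (random) approximation $g_k$ of $\nabla f(x_k)$ satisfies $\mathbb{E}_{k,q}[|(g_k-\nabla f(x_k))^{\mathsf T}q_k|]\le\theta_k^2\,\mathbb{E}_{k,q}[|g_k^{\mathsf T}q_k|]+\sigma_k^2$. (B) $\mathbb{E}_k[\|(H_k-\nabla^2 f(x_k))p_k\|_2^2]\le\gamma_H^2|\lambda_{\min,k}^-|^2\,\mathbb{E}_k[\|p_k\|_2^2]$ and $\mathbb{E}_k[|\lambda_k^--\lambda_{\min,k}^-|]\le\gamma_\lambda|\lambda_{\min,k}^-|$. (C) $\mathbb{E}_{\hat k}[\hat g_k]=\nabla f(\hat x_k)$ and $\mathbb{E}_{\hat k}[\|\hat g_k-\nabla f(\hat x_k)\|_2^2]\le\hat\theta_k^2\|\nabla f(\hat x_k)\|_2^2+\hat\sigma_k^2$. *)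

theory Defs
  imports "HOL-Probability.Probability"
begin

text \<open>Intended for symmetric matrices, whose (real) spectrum is finite and nonempty.\<close>
definition lambda_min :: "real^'n^'n \<Rightarrow> real" where
  "lambda_min A = (LEAST l. \<exists>v. v \<noteq> 0 \<and> A *v v = l *\<^sub>R v)"

definition lambda_min_neg :: "real^'n^'n \<Rightarrow> real" where
  "lambda_min_neg A = min (lambda_min A) 0"

definition generated_sigma ::
    "'w measure \<Rightarrow> ('w \<Rightarrow> 'a::topological_space) set \<Rightarrow> 'w measure" where
  "generated_sigma M Xs =
     sigma (space M) (\<Union>X\<in>Xs. {X -` B \<inter> space M | B. B \<in> sets borel})"

text \<open>\<open>hist\<close> is the sigma-algebra generated by \<open>x\<^sub>0, \<dots>, x\<^sub>k\<close>, and \<open>hist_with\<close> the one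
  generated by \<open>x\<^sub>0, \<dots>, x\<^sub>k\<close> and one further random vector.\<close>
definition hist ::
    "'w measure \<Rightarrow> (nat \<Rightarrow> 'w \<Rightarrow> real^'n) \<Rightarrow> nat \<Rightarrow> 'w measure" where
  "hist M x k = generated_sigma M (x ` {..k})"

definition hist_with ::
    "'w measure \<Rightarrow> (nat \<Rightarrow> 'w \<Rightarrow> real^'n) \<Rightarrow> nat \<Rightarrow> ('w \<Rightarrow> real^'n) \<Rightarrow> 'w measure" where
  "hist_with M x k Z = generated_sigma M (insert Z (x ` {..k}))"

definition vec_cond_exp ::
    "'w measure \<Rightarrow> 'w measure \<Rightarrow> ('w \<Rightarrow> real^'n) \<Rightarrow> 'w \<Rightarrow> real^'n" where
  "vec_cond_exp M F X \<omega> = (\<chi> i. real_cond_exp M F (\<lambda>\<omega>'. X \<omega>' $ i) \<omega>)"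

text \<open>The iterates of the Stochastic Two-Step Method, for given random Hessian approximations
  \<open>H\<close>, directions \<open>p\<close> and gradient approximations \<open>ghat\<close>; here \<open>d\<^sub>k = - ghat\<^sub>k\<close>.\<close>
definition two_step_method ::
    "'w measure \<Rightarrow> real^'n \<Rightarrow> (nat \<Rightarrow> real) \<Rightarrow> (nat \<Rightarrow> real) \<Rightarrow>
     (nat \<Rightarrow> 'w \<Rightarrow> real^'n^'n) \<Rightarrow> (nat \<Rightarrow> 'w \<Rightarrow> real^'n) \<Rightarrow> (nat \<Rightarrow> 'w \<Rightarrow> real^'n) \<Rightarrow>
     (nat \<Rightarrow> 'w \<Rightarrow> real^'n) \<Rightarrow> (nat \<Rightarrow> 'w \<Rightarrow> real^'n) \<Rightarrow> bool" where
  "two_step_method M x0 \<alpha> \<beta> H p ghat x xhat \<longleftrightarrow>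
     (\<forall>k. H k \<in> borel_measurable M \<and> p k \<in> borel_measurable M \<and> ghat k \<in> borel_measurable M) \<and>
     (\<forall>\<omega>\<in>space M.
        x 0 \<omega> = x0 \<and>
        (\<forall>k. transpose (H k \<omega>) = H k \<omega> \<and>
             xhat k \<omega> = x k \<omega> + \<beta> k *\<^sub>R p k \<omega> \<and>
             x (Suc k) \<omega> = xhat k \<omega> + \<alpha> k *\<^sub>R (- ghat k \<omega>)))"

text \<open>In the three conditions below every random variable under a conditional expectation is
  required to be integrable: \<^const>\<open>real_cond_exp\<close> is only meaningful for such functions
  (and truncates infinite values to \<open>0\<close>).\<close>

definition condition_A ::
    "'w measure \<Rightarrow> (real^'n \<Rightarrow> real^'n) \<Rightarrow> real \<Rightarrow> real \<Rightarrow> (nat \<Rightarrow> real) \<Rightarrow> (nat \<Rightarrow> real) \<Rightarrow>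
     (nat \<Rightarrow> 'w \<Rightarrow> real^'n) \<Rightarrow> (nat \<Rightarrow> 'w \<Rightarrow> real^'n^'n) \<Rightarrow> (nat \<Rightarrow> 'w \<Rightarrow> real^'n) \<Rightarrow>
     (nat \<Rightarrow> 'w \<Rightarrow> real^'n) \<Rightarrow> (nat \<Rightarrow> 'w \<Rightarrow> real^'n) \<Rightarrow> bool" where
  "condition_A M gradf \<gamma> \<delta> \<theta> \<sigma> x H g q p \<longleftrightarrow>
     (\<forall>k. g k \<in> borel_measurable M \<and> q k \<in> borel_measurable M \<and>
       (\<forall>\<omega>\<in>space M.
          if lambda_min (H k \<omega>) \<ge> 0 then p k \<omega> = 0 \<and> q k \<omega> = 0
          else p k \<omega> = (if g k \<omega> \<bullet> q k \<omega> \<le> 0 then q k \<omega> else - q k \<omega>) \<and>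
               q k \<omega> \<bullet> (H k \<omega> *v q k \<omega>) \<le> \<gamma> * lambda_min (H k \<omega>) * (norm (q k \<omega>))\<^sup>2 \<and>
               \<gamma> * lambda_min (H k \<omega>) * (norm (q k \<omega>))\<^sup>2 < 0 \<and>
               norm (q k \<omega>) = \<delta> * \<bar>lambda_min (H k \<omega>)\<bar>) \<and>
       integrable M (\<lambda>\<omega>. \<bar>(g k \<omega> - gradf (x k \<omega>)) \<bullet> q k \<omega>\<bar>) \<and>
       integrable M (\<lambda>\<omega>. \<bar>g k \<omega> \<bullet> q k \<omega>\<bar>) \<and>
       (AE \<omega> in M.
          real_cond_exp M (hist_with M x k (q k)) (\<lambda>\<omega>. \<bar>(g k \<omega> - gradf (x k \<omega>)) \<bullet> q k \<omega>\<bar>) \<omega>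
          \<le> (\<theta> k)\<^sup>2 * real_cond_exp M (hist_with M x k (q k)) (\<lambda>\<omega>. \<bar>g k \<omega> \<bullet> q k \<omega>\<bar>) \<omega>
            + (\<sigma> k)\<^sup>2))"

definition condition_B ::
    "'w measure \<Rightarrow> (real^'n \<Rightarrow> real^'n^'n) \<Rightarrow> real \<Rightarrow> real \<Rightarrow>
     (nat \<Rightarrow> 'w \<Rightarrow> real^'n) \<Rightarrow> (nat \<Rightarrow> 'w \<Rightarrow> real^'n^'n) \<Rightarrow> (nat \<Rightarrow> 'w \<Rightarrow> real^'n) \<Rightarrow> bool" where
  "condition_B M hessf \<gamma>\<^sub>H \<gamma>\<^sub>l x H p \<longleftrightarrow>
     (\<forall>k.
       integrable M (\<lambda>\<omega>. (norm ((H k \<omega> - hessf (x k \<omega>)) *v p k \<omega>))\<^sup>2) \<and>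
       integrable M (\<lambda>\<omega>. (norm (p k \<omega>))\<^sup>2) \<and>
       integrable M (\<lambda>\<omega>. \<bar>lambda_min_neg (H k \<omega>) - lambda_min_neg (hessf (x k \<omega>))\<bar>) \<and>
       (AE \<omega> in M.
          real_cond_exp M (hist M x k) (\<lambda>\<omega>. (norm ((H k \<omega> - hessf (x k \<omega>)) *v p k \<omega>))\<^sup>2) \<omega>
          \<le> \<gamma>\<^sub>H\<^sup>2 * \<bar>lambda_min_neg (hessf (x k \<omega>))\<bar>\<^sup>2
            * real_cond_exp M (hist M x k) (\<lambda>\<omega>. (norm (p k \<omega>))\<^sup>2) \<omega>) \<and>
       (AE \<omega> in M.
          real_cond_exp M (hist M x k)
            (\<lambda>\<omega>. \<bar>lambda_min_neg (H k \<omega>) - lambda_min_neg (hessf (x k \<omega>))\<bar>) \<omega>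
          \<le> \<gamma>\<^sub>l * \<bar>lambda_min_neg (hessf (x k \<omega>))\<bar>))"

definition condition_C ::
    "'w measure \<Rightarrow> (real^'n \<Rightarrow> real^'n) \<Rightarrow> (nat \<Rightarrow> real) \<Rightarrow> (nat \<Rightarrow> real) \<Rightarrow>
     (nat \<Rightarrow> 'w \<Rightarrow> real^'n) \<Rightarrow> (nat \<Rightarrow> 'w \<Rightarrow> real^'n) \<Rightarrow> (nat \<Rightarrow> 'w \<Rightarrow> real^'n) \<Rightarrow> bool" where
  "condition_C M gradf \<theta>hat \<sigma>hat x xhat ghat \<longleftrightarrow>
     (\<forall>k.
       integrable M (ghat k) \<and>
       integrable M (\<lambda>\<omega>. (norm (ghat k \<omega> - gradf (xhat k \<omega>)))\<^sup>2) \<and>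
       (AE \<omega> in M.
          vec_cond_exp M (hist_with M x k (xhat k)) (ghat k) \<omega> = gradf (xhat k \<omega>)) \<and>
       (AE \<omega> in M.
          real_cond_exp M (hist_with M x k (xhat k))
            (\<lambda>\<omega>. (norm (ghat k \<omega> - gradf (xhat k \<omega>)))\<^sup>2) \<omega>
          \<le> (\<theta>hat k)\<^sup>2 * (norm (gradf (xhat k \<omega>)))\<^sup>2 + (\<sigma>hat k)\<^sup>2))"

end

theory Submission
  imports Defs
begin

text \<open>
  Along one iteration the expected objective value satisfies
  \[ E f(x_{k+1}) \le E f(x_k) + \beta_k \sigma^2 - \frac{\alpha_k}{2} E \|\nabla f(\hat x_k)\|^2
       + \frac{L_g \hat\sigma^2}{2} \alpha_k^2. \]
  Since \<open>f\<close> is bounded below and the \<open>\<beta>\<^sub>k\<close> and \<open>\<alpha>\<^sub>k\<^sup>2\<close> are summable, the series of the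
  \<open>\<alpha>\<^sub>k E \<parallel>\<nabla>f(xhat\<^sub>k)\<parallel>\<^sup>2\<close> converges; as the \<open>\<alpha>\<^sub>k\<close> themselves are not summable, the expectations
  come arbitrarily close to 0. Passing from \<open>xhat\<^sub>k\<close> back to \<open>x\<^sub>k\<close> costs at most
  \<open>L\<^sub>g \<beta>\<^sub>k E \<parallel>p\<^sub>k\<parallel>\<close>, where \<open>\<beta>\<^sub>k\<close> tends to 0 and \<open>E \<parallel>p\<^sub>k\<parallel>\<close> is bounded uniformly in \<open>k\<close>.

  The inequality combines two steps. The gradient step (\<open>gradient_step_decrease\<close>) is
  the usual analysis of stochastic gradient descent. The curvature step
  (\<open>curvature_step_decrease\<close>) is the delicate one. Write \<open>l = \<parallel>p\<^sub>k\<parallel> / \<delta>\<close> for the size of the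
  negative eigenvalue of \<open>H\<^sub>k\<close> and \<open>\<Lambda>\<close> for that of the true Hessian at \<open>x\<^sub>k\<close>. By a cubic Taylor bound
  the second and third order terms of the change in \<open>f\<close> are at most
  \[ \frac{\beta^2}{2} \left( \|(H_k - \nabla^2 f(x_k)) p_k\| \, \|p_k\| - \gamma \delta^2 l^3 \right)
     + \frac{L_H}{6} \beta^3 \delta^3 l^3. \]
  The Hessian error is controlled by \<open>\<gamma>\<^sub>H E(\<Lambda> \<parallel>p\<^sub>k\<parallel>\<^sup>2)\<close> (\<open>integral_error_times_step_le\<close>), and this
  by \<open>\<delta>\<^sup>2 \<gamma>\<^sub>H / (1 - \<gamma>\<^sub>l) E(l\<^sup>3)\<close> (\<open>third_moment_ge\<close>), so that the bound on \<open>\<beta>\<close> makes the total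
  nonpositive. What remains is the slope term \<open>\<beta> E(\<nabla>f(x\<^sub>k) \<bullet> p\<^sub>k)\<close>, which the choice of the sign of
  \<open>p\<^sub>k\<close> keeps below \<open>\<beta> \<sigma>\<^sup>2\<close> (\<open>integral_gradient_times_step_le\<close>).

  Total expectations suffice throughout. The conditional bounds on the curvature enter after
  multiplication by a nonnegative weight that is measurable for the conditioning sigma-algebra
  (\<open>weighted_integral_le_of_cond_exp_le\<close>); choosing the weight well and applying Young's inequality
  pointwise replaces conditional versions of the Cauchy-Schwarz and Hoelder inequalities.
  The weights are functions of \<open>\<Lambda>\<close>, so \<open>\<Lambda>\<close> has to be a bounded Borel function of
  \<open>x\<^sub>k\<close>; this rests on the symmetry of the Hessian and on the variational description of the smallest
  eigenvalue.
\<close>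

section \<open>Taylor bounds and the Hessian\<close>

lemma le_if_le_add_small:
  fixes a b c :: real
  assumes "\<And>t. 0 < t \<Longrightarrow> t \<le> 1 \<Longrightarrow> a \<le> b + t * c"
  shows "a \<le> b"
proof (rule tendsto_lowerbound)
  show "((\<lambda>t. b + t * c) \<longlongrightarrow> b) (at_right 0)"
    by (auto intro!: tendsto_eq_intros)
  show "\<forall>\<^sub>F t in at_right 0. a \<le> b + t * c"
    unfolding eventually_at_right_field using assms by (intro exI[of _ 1]) auto
qed simp

text \<open>One integration of a polynomial bound on the derivative. Applied to the slope and then to the
  value of \<open>f\<close> along a line, it yields the Taylor bounds below.\<close>

lemma integrated_quadratic_bound:
  fixes \<phi> \<phi>' :: "real \<Rightarrow> real"
  assumes deriv: "\<And>t. 0 \<le> t \<Longrightarrow> t \<le> 1 \<Longrightarrow> (\<phi> has_real_derivative \<phi>' t) (at t)"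
    and bound: "\<And>t. 0 \<le> t \<Longrightarrow> t \<le> 1 \<Longrightarrow> \<phi>' t \<le> a + b * t + c * t\<^sup>2"
    and t: "0 \<le> t" "t \<le> 1"
  shows "\<phi> t \<le> \<phi> 0 + a * t + b / 2 * t\<^sup>2 + c / 3 * t ^ 3"
proof -
  let ?d = "\<lambda>t. a * t + b / 2 * t\<^sup>2 + c / 3 * t ^ 3 - \<phi> t"
  have "?d 0 \<le> ?d t"
  proof (rule DERIV_nonneg_imp_nondecreasing[where f = ?d])
    fix s assume s: "0 \<le> s" "s \<le> t"
    have "(?d has_real_derivative a + b * s + c * s\<^sup>2 - \<phi>' s) (at s)"
      using s t by (auto intro!: derivative_eq_intros deriv simp: power2_eq_square)
    then show "\<exists>y. (?d has_real_derivative y) (at s) \<and> 0 \<le> y"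
      using bound[of s] s t by force
  qed (use t in auto)
  then show ?thesis by simp
qed

lemma norm_matrix_vector_le_onorm:
  fixes A :: "real^'n^'m"
  shows "norm (A *v v) \<le> onorm (\<lambda>v. A *v v) * norm v"
  by (rule onorm[OF matrix_vector_mul_bounded_linear])

locale smooth_objective =
  fixes f :: "real^'n \<Rightarrow> real"
    and gradf :: "real^'n \<Rightarrow> real^'n"
    and hessf :: "real^'n \<Rightarrow> real^'n^'n"
    and L\<^sub>g L\<^sub>H fbar :: real
  assumes grad: "\<And>y. GDERIV f y :> gradf y"
    and hess: "\<And>y. (gradf has_derivative (\<lambda>h. hessf y *v h)) (at y)"
    and hess_cont: "continuous_on UNIV hessf"
    and L_pos: "L\<^sub>g > 0" "L\<^sub>H > 0"
    and grad_lipschitz: "\<And>y z. norm (gradf y - gradf z) \<le> L\<^sub>g * norm (y - z)"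
    and hess_lipschitz: "\<And>y z. onorm (\<lambda>v. (hessf y - hessf z) *v v) \<le> L\<^sub>H * norm (y - z)"
    and bounded_below: "\<And>y. fbar \<le> f y"
begin

lemma f_borel [measurable]: "f \<in> borel_measurable borel"
proof -
  have "continuous_on UNIV f"
    using grad unfolding gderiv_def
    by (meson continuous_at_imp_continuous_on has_derivative_continuous)
  then show ?thesis by (rule borel_measurable_continuous_onI)
qed

lemma gradf_borel [measurable]: "gradf \<in> borel_measurable borel"
proof -
  have "continuous_on UNIV gradf"
    using hess by (meson continuous_at_imp_continuous_on has_derivative_continuous)
  then show ?thesis by (rule borel_measurable_continuous_onI)
qed

lemma f_line_deriv:
  "((\<lambda>t. f (y + t *\<^sub>R s)) has_real_derivative gradf (y + t *\<^sub>R s) \<bullet> s) (at t)"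
proof -
  have "((\<lambda>t. f (y + t *\<^sub>R s)) has_derivative (\<lambda>u. (u *\<^sub>R s) \<bullet> gradf (y + t *\<^sub>R s))) (at t)"
    by (rule has_derivative_compose[where g = f, OF _ grad[unfolded gderiv_def]])
       (auto intro!: derivative_eq_intros)
  then show ?thesis
    by (simp add: has_field_derivative_def mult_commute_abs inner_commute)
qed

lemma gradf_line_deriv:
  "((\<lambda>t. gradf (y + t *\<^sub>R s) \<bullet> v) has_real_derivative (hessf (y + t *\<^sub>R s) *v s) \<bullet> v) (at t)"
proof -
  have "((\<lambda>t. gradf (y + t *\<^sub>R s)) has_derivative
      (\<lambda>u. hessf (y + t *\<^sub>R s) *v (u *\<^sub>R s))) (at t)"
    by (rule has_derivative_compose[where g = gradf, OF _ hess])
       (auto intro!: derivative_eq_intros)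
  then have "((\<lambda>t. gradf (y + t *\<^sub>R s) \<bullet> v) has_derivative
      (\<lambda>u. (hessf (y + t *\<^sub>R s) *v (u *\<^sub>R s)) \<bullet> v)) (at t)"
    by (rule has_derivative_inner_left)
  then show ?thesis
    by (simp add: has_field_derivative_def mult_commute_abs matrix_vector_mult_scaleR)
qed

lemma hess_lipschitz_vec:
  "norm (hessf y *v v - hessf z *v v) \<le> L\<^sub>H * norm (y - z) * norm v"
proof -
  have "norm ((hessf y - hessf z) *v v) \<le> L\<^sub>H * norm (y - z) * norm v"
    by (rule order_trans[OF norm_matrix_vector_le_onorm mult_right_mono[OF hess_lipschitz]]) simp
  then show ?thesis by (simp add: matrix_vector_mult_diff_rdistrib)
qed

lemma f_upper_quadratic: "f (y + s) \<le> f y + gradf y \<bullet> s + L\<^sub>g / 2 * (norm s)\<^sup>2"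
proof -
  have "f (y + 1 *\<^sub>R s) \<le> f (y + 0 *\<^sub>R s) + (gradf y \<bullet> s) * 1
      + (L\<^sub>g * (norm s)\<^sup>2) / 2 * 1\<^sup>2 + 0 / 3 * 1 ^ 3"
  proof (rule integrated_quadratic_bound)
    fix t :: real assume t: "0 \<le> t" "t \<le> 1"
    show "((\<lambda>t. f (y + t *\<^sub>R s)) has_real_derivative gradf (y + t *\<^sub>R s) \<bullet> s) (at t)"
      by (rule f_line_deriv)
    have "(gradf (y + t *\<^sub>R s) - gradf y) \<bullet> s \<le> norm (gradf (y + t *\<^sub>R s) - gradf y) * norm s"
      by (rule norm_cauchy_schwarz)
    also have "\<dots> \<le> (L\<^sub>g * norm (t *\<^sub>R s)) * norm s"
      by (rule mult_right_mono) (use grad_lipschitz[of "y + t *\<^sub>R s" y] in auto)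
    finally show "gradf (y + t *\<^sub>R s) \<bullet> s \<le> gradf y \<bullet> s + L\<^sub>g * (norm s)\<^sup>2 * t + 0 * t\<^sup>2"
      using t by (simp add: inner_diff_left power2_eq_square algebra_simps)
  qed auto
  then show ?thesis by simp
qed

lemma f_upper_cubic:
  "f (y + s) \<le> f y + gradf y \<bullet> s + 1 / 2 * (s \<bullet> (hessf y *v s)) + L\<^sub>H / 6 * (norm s) ^ 3"
proof -
  have *: "gradf (y + t *\<^sub>R s) \<bullet> s \<le> gradf (y + 0 *\<^sub>R s) \<bullet> s
      + ((hessf y *v s) \<bullet> s) * t + (L\<^sub>H * (norm s) ^ 3) / 2 * t\<^sup>2 + 0 / 3 * t ^ 3"
    if "0 \<le> t" "t \<le> 1" for t
  proof (rule integrated_quadratic_bound)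
    fix t :: real assume t: "0 \<le> t" "t \<le> 1"
    show "((\<lambda>t. gradf (y + t *\<^sub>R s) \<bullet> s) has_real_derivative
        (hessf (y + t *\<^sub>R s) *v s) \<bullet> s) (at t)"
      by (rule gradf_line_deriv)
    have "(hessf (y + t *\<^sub>R s) *v s - hessf y *v s) \<bullet> s
        \<le> norm (hessf (y + t *\<^sub>R s) *v s - hessf y *v s) * norm s"
      by (rule norm_cauchy_schwarz)
    also have "\<dots> \<le> (L\<^sub>H * norm (t *\<^sub>R s) * norm s) * norm s"
      by (rule mult_right_mono) (use hess_lipschitz_vec[of "y + t *\<^sub>R s" s y] in auto)
    finally show "(hessf (y + t *\<^sub>R s) *v s) \<bullet> s
        \<le> (hessf y *v s) \<bullet> s + L\<^sub>H * (norm s) ^ 3 * t + 0 * t\<^sup>2"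
      using t by (simp add: inner_diff_left power3_eq_cube algebra_simps)
  qed (use that in auto)
  have "f (y + 1 *\<^sub>R s) \<le> f (y + 0 *\<^sub>R s) + (gradf y \<bullet> s) * 1
      + ((hessf y *v s) \<bullet> s) / 2 * 1\<^sup>2 + (L\<^sub>H * (norm s) ^ 3 / 2) / 3 * 1 ^ 3"
  proof (rule integrated_quadratic_bound)
    fix t :: real assume t: "0 \<le> t" "t \<le> 1"
    show "((\<lambda>t. f (y + t *\<^sub>R s)) has_real_derivative gradf (y + t *\<^sub>R s) \<bullet> s) (at t)"
      by (rule f_line_deriv)
    show "gradf (y + t *\<^sub>R s) \<bullet> s \<le> gradf y \<bullet> s + (hessf y *v s) \<bullet> s * t
        + L\<^sub>H * norm s ^ 3 / 2 * t\<^sup>2"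
      using *[OF t] by simp
  qed auto
  then show ?thesis by (simp add: inner_commute)
qed

lemma gradf_linearization:
  "norm (gradf (y + s) - gradf y - hessf y *v s) \<le> L\<^sub>H * (norm s)\<^sup>2"
proof -
  have "norm (gradf (y + s) - gradf y - hessf y *v (y + s - y)) \<le> norm (y + s - y) * (L\<^sub>H * norm s)"
  proof (rule differentiable_bound_linearization[where S = "closed_segment y (y + s)"
        and f' = "\<lambda>z h. hessf z *v h"])
    show "y + t *\<^sub>R (y + s - y) \<in> closed_segment y (y + s)" if "t \<in> {0..1}" for t
      using that by (auto simp: closed_segment_def algebra_simps intro!: exI[of _ t])
    show "(gradf has_derivative (*v) (hessf z)) (at z within closed_segment y (y + s))" for z
      by (rule has_derivative_at_withinI[OF hess])
    fix z assume "z \<in> closed_segment y (y + s)"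
    then have "norm (z - y) \<le> norm s"
      by (metis add_diff_cancel_left' norm_minus_commute segment_bound1)
    then have "L\<^sub>H * norm (z - y) \<le> L\<^sub>H * norm s"
      using L_pos by simp
    moreover have "(*v) (hessf z) - (*v) (hessf y) = (\<lambda>v. (hessf z - hessf y) *v v)"
      by (auto simp: fun_diff_def matrix_vector_mult_diff_rdistrib)
    ultimately show "onorm ((*v) (hessf z) - (*v) (hessf y)) \<le> L\<^sub>H * norm s"
      using hess_lipschitz[of z y] by simp
  qed auto
  then show ?thesis by (simp add: power2_eq_square mult.commute mult.left_commute)
qed

text \<open>A Lipschitz constant of \<^term>\<open>gradf\<close> bounds its derivative: linearize along \<open>t h\<close>, divide by \<open>t\<close>
  and let \<open>t \<rightarrow> 0\<close>.\<close>

lemma norm_hess_vec_le: "norm (hessf y *v h) \<le> L\<^sub>g * norm h"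
proof (rule le_if_le_add_small)
  fix t :: real assume t: "0 < t"
  have "norm (hessf y *v (t *\<^sub>R h)) \<le> norm (gradf (y + t *\<^sub>R h) - gradf y)
      + norm (gradf (y + t *\<^sub>R h) - gradf y - hessf y *v (t *\<^sub>R h))"
    by (metis norm_minus_commute norm_triangle_sub)
  also have "\<dots> \<le> L\<^sub>g * norm (t *\<^sub>R h) + L\<^sub>H * (norm (t *\<^sub>R h))\<^sup>2"
    using grad_lipschitz[of "y + t *\<^sub>R h" y] gradf_linearization[of y "t *\<^sub>R h"] by simp
  finally have "t * norm (hessf y *v h) \<le> t * (L\<^sub>g * norm h + t * (L\<^sub>H * (norm h)\<^sup>2))"
    using t by (simp add: matrix_vector_mult_scaleR power2_eq_square algebra_simps)
  then show "norm (hessf y *v h) \<le> L\<^sub>g * norm h + t * (L\<^sub>H * (norm h)\<^sup>2)"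
    using t by simp
qed

text \<open>The mean value theorem in the direction \<open>v\<close> turns the second difference into a difference of two
  gradients, each of which is linearized at the same base point \<open>y\<close>. Exchanging \<open>u\<close> and \<open>v\<close> does not
  change the second difference, so the limit \<open>t \<rightarrow> 0\<close> gives the symmetry of the Hessian.\<close>

lemma second_difference:
  assumes t: "0 < t"
  shows "\<bar>f (y + t *\<^sub>R u + t *\<^sub>R v) - f (y + t *\<^sub>R u) - (f (y + t *\<^sub>R v) - f y)
      - t\<^sup>2 * ((hessf y *v u) \<bullet> v)\<bar>
    \<le> t ^ 3 * (2 * L\<^sub>H * (norm u + norm v)\<^sup>2 * norm v)"
proof -
  let ?a = "\<lambda>r. gradf (y + t *\<^sub>R u + r *\<^sub>R v)" and ?b = "\<lambda>r. gradf (y + r *\<^sub>R v)"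
  let ?d = "\<lambda>r. f (y + t *\<^sub>R u + r *\<^sub>R v) - f (y + r *\<^sub>R v)"
  have "\<exists>r>0. r < t \<and> ?d t - ?d 0 = (t - 0) * (?a r \<bullet> v - ?b r \<bullet> v)"
    by (rule MVT2) (use t in \<open>auto intro!: derivative_eq_intros f_line_deriv\<close>)
  then obtain r where r: "0 < r" "r < t"
    and mvt: "?d t - ?d 0 = t * (?a r \<bullet> v - ?b r \<bullet> v)" by auto
  let ?e = "\<lambda>s. gradf (y + s) - gradf y - hessf y *v s"
  have e: "norm (?e s) \<le> L\<^sub>H * (t * (norm u + norm v))\<^sup>2"
    if "norm s \<le> t * (norm u + norm v)" for s
    using gradf_linearization[of y s] L_pos that
    by (meson mult_left_mono norm_ge_zero order_less_imp_le order_trans power_mono)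
  have rv: "r * norm v \<le> t * norm v" using r by (simp add: mult_right_mono)
  then have nb: "norm (r *\<^sub>R v) \<le> t * (norm u + norm v)"
    using r t by (simp add: distrib_left add_increasing)
  have "norm (t *\<^sub>R u + r *\<^sub>R v) \<le> t * norm u + r * norm v"
    using norm_triangle_ineq[of "t *\<^sub>R u" "r *\<^sub>R v"] r t by simp
  then have na: "norm (t *\<^sub>R u + r *\<^sub>R v) \<le> t * (norm u + norm v)"
    using rv by (simp add: distrib_left)
  have "?a r - ?b r - t *\<^sub>R (hessf y *v u) = ?e (t *\<^sub>R u + r *\<^sub>R v) - ?e (r *\<^sub>R v)"
    by (simp add: matrix_vector_right_distrib matrix_vector_mult_scaleR add.assoc)
  also have "norm \<dots> \<le> norm (?e (t *\<^sub>R u + r *\<^sub>R v)) + norm (?e (r *\<^sub>R v))"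
    by (rule norm_triangle_ineq4)
  also have "\<dots> \<le> 2 * L\<^sub>H * (t * (norm u + norm v))\<^sup>2"
    using e[OF na] e[OF nb] by linarith
  finally have "norm (?a r - ?b r - t *\<^sub>R (hessf y *v u)) \<le> 2 * L\<^sub>H * (t * (norm u + norm v))\<^sup>2" .
  then have "\<bar>(?a r - ?b r - t *\<^sub>R (hessf y *v u)) \<bullet> v\<bar> \<le> 2 * L\<^sub>H * (t * (norm u + norm v))\<^sup>2 * norm v"
    by (meson Cauchy_Schwarz_ineq2 mult_right_mono norm_ge_zero order_trans)
  from mult_left_mono[OF this, of t] t
  have "\<bar>t * ((?a r - ?b r - t *\<^sub>R (hessf y *v u)) \<bullet> v)\<bar>
      \<le> t * (2 * L\<^sub>H * (t * (norm u + norm v))\<^sup>2 * norm v)"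
    by (simp add: abs_mult)
  also have "t * ((?a r - ?b r - t *\<^sub>R (hessf y *v u)) \<bullet> v) = ?d t - ?d 0 - t\<^sup>2 * ((hessf y *v u) \<bullet> v)"
    unfolding mvt by (simp add: inner_diff_left power2_eq_square algebra_simps)
  also have "t * (2 * L\<^sub>H * (t * (norm u + norm v))\<^sup>2 * norm v)
      = t ^ 3 * (2 * L\<^sub>H * (norm u + norm v)\<^sup>2 * norm v)"
    by (simp add: power2_eq_square power3_eq_cube algebra_simps)
  finally show ?thesis by (simp add: algebra_simps)
qed

lemma transpose_hess: "transpose (hessf y) = hessf y"
proof -
  have le: "(hessf y *v u) \<bullet> v \<le> (hessf y *v v) \<bullet> u" for u v
  proof (rule le_if_le_add_small)
    fix t :: real assume t: "0 < t"
    define K where "K u v = 2 * L\<^sub>H * (norm u + norm v)\<^sup>2 * norm v" for u v :: "real^'n"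
    have "t\<^sup>2 * ((hessf y *v u) \<bullet> v) \<le> t\<^sup>2 * ((hessf y *v v) \<bullet> u) + t ^ 3 * K u v + t ^ 3 * K v u"
      using second_difference[OF t, of y u v] second_difference[OF t, of y v u]
      by (simp add: K_def add.assoc add.commute[of "t *\<^sub>R v"])
    also have "\<dots> = t\<^sup>2 * ((hessf y *v v) \<bullet> u + t * (K u v + K v u))"
      by (simp add: power2_eq_square power3_eq_cube algebra_simps)
    finally show "(hessf y *v u) \<bullet> v \<le> (hessf y *v v) \<bullet> u + t * (K u v + K v u)"
      using t by simp
  qed
  have "(transpose (hessf y) *v u) \<bullet> v = (hessf y *v u) \<bullet> v" for u v
    using le[of u v] le[of v u]
    by (metis antisym dot_lmul_matrix inner_commute transpose_matrix_vector)
  then have "transpose (hessf y) *v u = hessf y *v u" for u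
    by (rule vector_eq_rdot[THEN iffD1, rule_format])
  then show ?thesis by (simp add: matrix_eq)
qed

end

section \<open>The smallest eigenvalue\<close>

text \<open>The minimum of the Rayleigh quotient is attained on the compact unit sphere, and a minimizer is
  an eigenvector: \<open>A - m I\<close> is positive semidefinite, hence its quadratic form can vanish only on its
  kernel. This also shows that the \<open>LEAST\<close> in the definition of \<^const>\<open>lambda_min\<close> exists.\<close>

lemma symmetric_smallest_eigenvector:
  fixes A :: "real^'n^'n"
  assumes sym: "transpose A = A"
  obtains v where "norm v = 1" "A *v v = lambda_min A *\<^sub>R v"
    "\<And>w. lambda_min A * (norm w)\<^sup>2 \<le> w \<bullet> (A *v w)"
proof -
  have "continuous_on (sphere 0 1) (\<lambda>v. v \<bullet> (A *v v))"
    by (intro continuous_intros linear_continuous_on matrix_vector_mul_bounded_linear)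
  moreover have "sphere 0 1 \<noteq> ({} :: (real^'n) set)"
    by simp
  ultimately obtain v where v: "norm v = 1"
    and min: "\<And>w. norm w = 1 \<Longrightarrow> v \<bullet> (A *v v) \<le> w \<bullet> (A *v w)"
    using continuous_attains_inf[of "sphere 0 1" "\<lambda>v. v \<bullet> (A *v v)"] by auto
  define m where "m = v \<bullet> (A *v v)"
  have form: "m * (norm w)\<^sup>2 \<le> w \<bullet> (A *v w)" for w
  proof (cases "w = 0")
    case False
    then have "m \<le> ((1 / norm w) *\<^sub>R w) \<bullet> (A *v ((1 / norm w) *\<^sub>R w))"
      unfolding m_def by (intro min) simp
    then show ?thesis
      using False by (simp add: matrix_vector_mult_scaleR field_simps power2_eq_square)
  qed simp
  have symi: "a \<bullet> (A *v b) = b \<bullet> (A *v a)" for a b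
    by (metis dot_lmul_matrix inner_commute sym transpose_matrix_vector)
  define z where "z = A *v v - m *\<^sub>R v"
  \<comment> \<open>Moving from the minimizer a small distance along \<open>- z\<close> would decrease the form if \<open>z \<noteq> 0\<close>.\<close>
  have "2 * (z \<bullet> z) \<le> 0"
  proof (rule le_if_le_add_small)
    fix t :: real assume t: "0 < t"
    have nv: "v \<bullet> v = 1" using v by (simp add: dot_square_norm)
    have Av: "A *v v = z + m *\<^sub>R v" by (simp add: z_def)
    have "0 \<le> (v - t *\<^sub>R z) \<bullet> (A *v (v - t *\<^sub>R z)) - m * ((v - t *\<^sub>R z) \<bullet> (v - t *\<^sub>R z))"
      using form[of "v - t *\<^sub>R z"] by (simp add: power2_norm_eq_inner)
    also have "\<dots> = (v \<bullet> (A *v v) - m * (v \<bullet> v)) - 2 * t * (z \<bullet> (A *v v) - m * (z \<bullet> v))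
        + t * t * (z \<bullet> (A *v z) - m * (z \<bullet> z))"
      by (simp add: matrix_vector_mult_diff_distrib matrix_vector_mult_scaleR inner_diff_left
          inner_diff_right symi[of v z] inner_commute[of v z] algebra_simps)
    also have "v \<bullet> (A *v v) - m * (v \<bullet> v) = 0" using nv by (simp add: m_def)
    also have "z \<bullet> (A *v v) - m * (z \<bullet> v) = z \<bullet> z" by (simp add: Av inner_add_right)
    finally have "t * (2 * (z \<bullet> z)) \<le> t * (t * (z \<bullet> (A *v z) - m * (z \<bullet> z)))"
      by (simp add: algebra_simps)
    then show "2 * (z \<bullet> z) \<le> 0 + t * (z \<bullet> (A *v z) - m * (z \<bullet> z))"
      using t by simp
  qed
  then have "z = 0"
    by (metis inner_gt_zero_iff mult_pos_pos not_le zero_less_numeral)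
  then have eig: "A *v v = m *\<^sub>R v"
    by (simp add: z_def)
  have "lambda_min A = m"
    unfolding lambda_min_def
  proof (rule Least_equality)
    show "\<exists>v. v \<noteq> 0 \<and> A *v v = m *\<^sub>R v" using eig v by (intro exI[of _ v]) auto
    fix l assume "\<exists>v. v \<noteq> 0 \<and> A *v v = l *\<^sub>R v"
    then obtain w where w: "w \<noteq> 0" "A *v w = l *\<^sub>R w" by blast
    have "m * (norm w)\<^sup>2 \<le> l * (norm w)\<^sup>2" using form[of w] w by (simp add: power2_norm_eq_inner)
    then show "m \<le> l" using w by simp
  qed
  then show thesis using that[OF v] eig form by simp
qed

section \<open>Generated sigma-algebras and conditional expectation\<close>

lemma subalgebra_generated_sigma:
  assumes "\<And>X. X \<in> Xs \<Longrightarrow> X \<in> borel_measurable M"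
  shows "subalgebra M (generated_sigma M Xs)"
proof -
  have "(\<Union>X\<in>Xs. {X -` B \<inter> space M | B. B \<in> sets borel}) \<subseteq> sets M"
    using assms by (auto intro: measurable_sets)
  moreover have "(\<Union>X\<in>Xs. {X -` B \<inter> space M | B. B \<in> sets borel}) \<subseteq> Pow (space M)"
    by auto
  ultimately show ?thesis
    unfolding subalgebra_def generated_sigma_def
    by (simp add: space_measure_of sets_measure_of sets.sigma_sets_subset)
qed

lemma generated_sigma_measurable:
  assumes "X \<in> Xs"
  shows "X \<in> borel_measurable (generated_sigma M Xs)"
proof (rule measurableI)
  fix B :: "'b set" assume "B \<in> sets borel"
  have "(\<Union>X\<in>Xs. {X -` B \<inter> space M | B. B \<in> sets borel}) \<subseteq> Pow (space M)"
    by auto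
  then show "X -` B \<inter> space (generated_sigma M Xs) \<in> sets (generated_sigma M Xs)"
    unfolding generated_sigma_def using assms \<open>B \<in> sets borel\<close>
    by (auto simp: space_measure_of sets_measure_of intro!: sigma_sets.Basic)
qed simp

text \<open>Turns a conditional bound into one between total expectations. The terms \<open>\<phi>\<close> and \<open>\<psi>\<close> cover errors that are
  relative to another random variable and errors that are absolute.\<close>

lemma (in finite_measure_subalgebra) weighted_integral_le_of_cond_exp_le:
  fixes w \<phi> \<psi> X Y :: "'a \<Rightarrow> real"
  assumes le: "AE \<omega> in M. real_cond_exp M F X \<omega> \<le> \<phi> \<omega> * real_cond_exp M F Y \<omega> + \<psi> \<omega>"
    and w: "w \<in> borel_measurable F" "\<And>\<omega>. 0 \<le> w \<omega>"
    and \<phi>: "\<phi> \<in> borel_measurable F"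
    and XY: "X \<in> borel_measurable M" "Y \<in> borel_measurable M"
    and int: "integrable M (\<lambda>\<omega>. w \<omega> * X \<omega>)" "integrable M (\<lambda>\<omega>. w \<omega> * \<phi> \<omega> * Y \<omega>)"
      "integrable M (\<lambda>\<omega>. w \<omega> * \<psi> \<omega>)"
  shows "(\<integral>\<omega>. w \<omega> * X \<omega> \<partial>M) \<le> (\<integral>\<omega>. w \<omega> * \<phi> \<omega> * Y \<omega> \<partial>M) + (\<integral>\<omega>. w \<omega> * \<psi> \<omega> \<partial>M)"
proof -
  have w\<phi>: "(\<lambda>\<omega>. w \<omega> * \<phi> \<omega>) \<in> borel_measurable F"
    using w \<phi> by measurable
  note X = real_cond_exp_intg[OF int(1) w(1) XY(1)]
  note Y = real_cond_exp_intg[OF int(2) w\<phi> XY(2)]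
  have "(\<integral>\<omega>. w \<omega> * X \<omega> \<partial>M) = (\<integral>\<omega>. w \<omega> * real_cond_exp M F X \<omega> \<partial>M)"
    using X by simp
  also have "\<dots> \<le> (\<integral>\<omega>. w \<omega> * \<phi> \<omega> * real_cond_exp M F Y \<omega> + w \<omega> * \<psi> \<omega> \<partial>M)"
  proof (rule integral_mono_AE)
    show "AE \<omega> in M. w \<omega> * real_cond_exp M F X \<omega>
        \<le> w \<omega> * \<phi> \<omega> * real_cond_exp M F Y \<omega> + w \<omega> * \<psi> \<omega>"
      using le
    proof eventually_elim
      case (elim \<omega>)
      then show ?case using mult_left_mono[OF elim w(2)[of \<omega>]] by (simp add: algebra_simps)
    qed
  qed (use X Y int in auto)
  also have "\<dots> = (\<integral>\<omega>. w \<omega> * \<phi> \<omega> * Y \<omega> \<partial>M) + (\<integral>\<omega>. w \<omega> * \<psi> \<omega> \<partial>M)"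
    using Y int by simp
  finally show ?thesis .
qed


context smooth_objective
begin

lemma lambda_min_neg_hess_bounded: "\<bar>lambda_min_neg (hessf y)\<bar> \<le> L\<^sub>g"
proof -
  obtain v where v: "norm v = 1" "hessf y *v v = lambda_min (hessf y) *\<^sub>R v"
    using symmetric_smallest_eigenvector[OF transpose_hess] .
  have "\<bar>lambda_min (hessf y)\<bar> \<le> L\<^sub>g"
    using norm_hess_vec_le[of y v] v by simp
  then show ?thesis by (simp add: lambda_min_neg_def)
qed

text \<open>A strict upper bound on the smallest eigenvalue is witnessed by a single vector \<open>v\<close>, so the
  sublevel sets are unions of open sets.\<close>

lemma lambda_min_neg_hess_borel [measurable]:
  "(\<lambda>y. lambda_min_neg (hessf y)) \<in> borel_measurable borel"
proof -
  have "(\<lambda>y. lambda_min (hessf y)) \<in> borel_measurable borel"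
  proof (rule borel_measurable_iff_less[THEN iffD2], intro allI)
    fix c
    have iff: "lambda_min (hessf y) < c \<longleftrightarrow> (\<exists>v. v \<bullet> (hessf y *v v) < c * (norm v)\<^sup>2)" for y
    proof
      obtain v where v: "norm v = 1" "hessf y *v v = lambda_min (hessf y) *\<^sub>R v"
        using symmetric_smallest_eigenvector[OF transpose_hess] .
      assume "lambda_min (hessf y) < c"
      then show "\<exists>v. v \<bullet> (hessf y *v v) < c * (norm v)\<^sup>2"
        using v by (intro exI[of _ v]) (simp add: power2_norm_eq_inner[symmetric])
    next
      assume "\<exists>v. v \<bullet> (hessf y *v v) < c * (norm v)\<^sup>2"
      then obtain v where "v \<bullet> (hessf y *v v) < c * (norm v)\<^sup>2" by blast
      moreover have "lambda_min (hessf y) * (norm v)\<^sup>2 \<le> v \<bullet> (hessf y *v v)"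
        using symmetric_smallest_eigenvector[OF transpose_hess] by metis
      ultimately have "lambda_min (hessf y) * (norm v)\<^sup>2 < c * (norm v)\<^sup>2" by linarith
      then show "lambda_min (hessf y) < c"
        by (simp add: mult_less_cancel_right)
    qed
    have "open {y. v \<bullet> (hessf y *v v) < c * (norm v)\<^sup>2}" for v
    proof (rule open_Collect_less)
      have "continuous_on UNIV (\<lambda>y. hessf y *v v)"
        unfolding matrix_vector_mult_def
        by (intro continuous_on_vec_lambda continuous_intros continuous_on_compose2[OF _ hess_cont]) auto
      then show "continuous_on UNIV (\<lambda>y. v \<bullet> (hessf y *v v))"
        by (intro continuous_intros)
    qed (intro continuous_intros)
    then have "open (\<Union>v. {y. v \<bullet> (hessf y *v v) < c * (norm v)\<^sup>2})" by blast
    also have "(\<Union>v. {y. v \<bullet> (hessf y *v v) < c * (norm v)\<^sup>2}) = {y. lambda_min (hessf y) < c}"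
      using iff by auto
    finally show "{y \<in> space borel. lambda_min (hessf y) < c} \<in> sets borel" by simp
  qed
  then show ?thesis unfolding lambda_min_neg_def by measurable
qed

end

section \<open>Moments of the curvature step\<close>

lemma integrable_of_abs_le:
  fixes u v :: "'a \<Rightarrow> real"
  assumes "integrable M v" "u \<in> borel_measurable M" "\<And>\<omega>. \<omega> \<in> space M \<Longrightarrow> \<bar>u \<omega>\<bar> \<le> v \<omega>"
  shows "integrable M u"
  using assms(1,2)
  by (rule Bochner_Integration.integrable_bound) (use assms(3) in \<open>fastforce intro: AE_I2\<close>)

text \<open>A Cauchy-Schwarz inequality: conditionally on \<open>F\<close>, the error \<open>e\<close> has root mean square at most
  \<open>c \<Lambda>\<close> times that of \<open>P\<close>. For positive \<open>s\<close>, Young's inequality gives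
  \<open>e P \<le> e\<^sup>2 / (2 s) + s P\<^sup>2 / 2\<close>, and the optimal choice is \<open>s = c \<Lambda>\<close>. As this may vanish, the proof takes
  \<open>s = (c + t) (\<Lambda> + t)\<close> and lets \<open>t \<rightarrow> 0\<close>.\<close>

lemma (in finite_measure_subalgebra) integral_error_times_step_le:
  fixes e P \<Lambda> :: "'a \<Rightarrow> real"
  assumes le: "AE \<omega> in M. real_cond_exp M F (\<lambda>\<omega>. (e \<omega>)\<^sup>2) \<omega>
      \<le> (c * \<Lambda> \<omega>)\<^sup>2 * real_cond_exp M F (\<lambda>\<omega>. (P \<omega>)\<^sup>2) \<omega>"
    and c: "0 \<le> c"
    and \<Lambda>: "\<Lambda> \<in> borel_measurable F" "\<And>\<omega>. 0 \<le> \<Lambda> \<omega>" "\<And>\<omega>. \<Lambda> \<omega> \<le> K"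
    and meas [measurable]: "e \<in> borel_measurable M" "P \<in> borel_measurable M"
    and int: "integrable M (\<lambda>\<omega>. (e \<omega>)\<^sup>2)" "integrable M (\<lambda>\<omega>. (P \<omega>)\<^sup>2)"
  shows "integrable M (\<lambda>\<omega>. e \<omega> * P \<omega>)"
    and "(\<integral>\<omega>. e \<omega> * P \<omega> \<partial>M) \<le> c * (\<integral>\<omega>. \<Lambda> \<omega> * (P \<omega>)\<^sup>2 \<partial>M)"
proof -
  have \<Lambda>M [measurable]: "\<Lambda> \<in> borel_measurable M"
    by (rule measurable_from_subalg[OF subalg \<Lambda>(1)])
  have young: "\<bar>a * b\<bar> \<le> a\<^sup>2 + b\<^sup>2" for a b :: real
  proof -
    have "2 * \<bar>a\<bar> * \<bar>b\<bar> \<le> a\<^sup>2 + b\<^sup>2" using sum_squares_bound[of "\<bar>a\<bar>" "\<bar>b\<bar>"] by simp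
    moreover have "0 \<le> \<bar>a\<bar> * \<bar>b\<bar>" by simp
    ultimately show ?thesis unfolding abs_mult by linarith
  qed
  show eP: "integrable M (\<lambda>\<omega>. e \<omega> * P \<omega>)"
    by (rule integrable_of_abs_le[OF Bochner_Integration.integrable_add[OF int]]) (measurable, rule young)
  have \<Lambda>P: "integrable M (\<lambda>\<omega>. \<Lambda> \<omega> * (P \<omega>)\<^sup>2)"
  proof (rule integrable_of_abs_le)
    show "integrable M (\<lambda>\<omega>. K * (P \<omega>)\<^sup>2)" using int by simp
    show "\<bar>\<Lambda> \<omega> * (P \<omega>)\<^sup>2\<bar> \<le> K * (P \<omega>)\<^sup>2" for \<omega>
      using \<Lambda>(2,3)[of \<omega>] by (simp add: abs_mult mult_right_mono)
  qed measurable
  let ?P2 = "\<integral>\<omega>. (P \<omega>)\<^sup>2 \<partial>M" and ?\<Lambda>P2 = "\<integral>\<omega>. \<Lambda> \<omega> * (P \<omega>)\<^sup>2 \<partial>M"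
  have P2: "0 \<le> ?P2" by simp
  show "(\<integral>\<omega>. e \<omega> * P \<omega> \<partial>M) \<le> c * ?\<Lambda>P2"
  proof (rule le_if_le_add_small)
    fix t :: real assume t: "0 < t" "t \<le> 1"
    define w where "w \<omega> = 1 / (2 * (c + t) * (\<Lambda> \<omega> + t))" for \<omega>
    have ct: "0 < c + t" using c t by simp
    have pos: "0 < \<Lambda> \<omega> + t" for \<omega> using \<Lambda>(2)[of \<omega>] t by simp
    have w0: "0 \<le> w \<omega>" for \<omega> using ct pos[of \<omega>] by (simp add: w_def)
    have wb: "w \<omega> \<le> 1 / (2 * (c + t) * t)" for \<omega>
    proof -
      have "2 * (c + t) * t \<le> 2 * (c + t) * (\<Lambda> \<omega> + t)"
        using \<Lambda>(2)[of \<omega>] c t by (intro mult_left_mono) auto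
      moreover have "0 < 2 * (c + t) * t" using c t by simp
      ultimately show ?thesis unfolding w_def by (intro frac_le) auto
    qed
    have wF: "w \<in> borel_measurable F" unfolding w_def using \<Lambda>(1) by measurable
    have wM [measurable]: "w \<in> borel_measurable M" by (rule measurable_from_subalg[OF subalg wF])
    have we: "integrable M (\<lambda>\<omega>. w \<omega> * (e \<omega>)\<^sup>2)"
    proof (rule integrable_of_abs_le)
      show "integrable M (\<lambda>\<omega>. 1 / (2 * (c + t) * t) * (e \<omega>)\<^sup>2)"
        by (rule integrable_mult_right) (rule int)
      show "\<bar>w \<omega> * (e \<omega>)\<^sup>2\<bar> \<le> 1 / (2 * (c + t) * t) * (e \<omega>)\<^sup>2" for \<omega>
        using mult_right_mono[OF wb[of \<omega>], of "(e \<omega>)\<^sup>2"] w0[of \<omega>] by (simp only: abs_mult) simp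
    qed measurable
    have w\<Lambda>: "w \<omega> * (c * \<Lambda> \<omega>)\<^sup>2 \<le> (c + t) / 2 * (\<Lambda> \<omega> + t)" for \<omega>
    proof -
      have "(c * \<Lambda> \<omega>)\<^sup>2 \<le> ((c + t) * (\<Lambda> \<omega> + t))\<^sup>2"
        using \<Lambda>(2)[of \<omega>] c t by (intro power_mono mult_mono) auto
      then have "w \<omega> * (c * \<Lambda> \<omega>)\<^sup>2 \<le> w \<omega> * ((c + t) * (\<Lambda> \<omega> + t))\<^sup>2"
        using w0 by (rule mult_left_mono)
      also have "\<dots> = (c + t) / 2 * (\<Lambda> \<omega> + t)"
      proof -
        have "1 / (2 * a * b) * (a * b)\<^sup>2 = a / 2 * b" if "0 < a" "0 < b" for a b :: real
          using that by (simp add: power2_eq_square)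
        then show ?thesis unfolding w_def using ct pos by blast
      qed
      finally show ?thesis .
    qed
    have \<Lambda>tP: "integrable M (\<lambda>\<omega>. (c + t) / 2 * (\<Lambda> \<omega> + t) * (P \<omega>)\<^sup>2)"
      using \<Lambda>P int by (simp add: distrib_left distrib_right mult.assoc)
    have w\<Lambda>P: "integrable M (\<lambda>\<omega>. w \<omega> * (c * \<Lambda> \<omega>)\<^sup>2 * (P \<omega>)\<^sup>2)"
    proof (rule integrable_of_abs_le[OF \<Lambda>tP])
      fix \<omega>
      have "0 \<le> w \<omega> * (c * \<Lambda> \<omega>)\<^sup>2 * (P \<omega>)\<^sup>2"
        by (intro mult_nonneg_nonneg w0) auto
      moreover have "w \<omega> * (c * \<Lambda> \<omega>)\<^sup>2 * (P \<omega>)\<^sup>2 \<le> (c + t) / 2 * (\<Lambda> \<omega> + t) * (P \<omega>)\<^sup>2"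
        by (rule mult_right_mono[OF w\<Lambda>]) simp
      ultimately show "\<bar>w \<omega> * (c * \<Lambda> \<omega>)\<^sup>2 * (P \<omega>)\<^sup>2\<bar> \<le> (c + t) / 2 * (\<Lambda> \<omega> + t) * (P \<omega>)\<^sup>2"
        by linarith
    qed measurable
    have "(\<integral>\<omega>. w \<omega> * (e \<omega>)\<^sup>2 \<partial>M) \<le> (\<integral>\<omega>. w \<omega> * (c * \<Lambda> \<omega>)\<^sup>2 * (P \<omega>)\<^sup>2 \<partial>M) + (\<integral>\<omega>. w \<omega> * 0 \<partial>M)"
    proof (rule weighted_integral_le_of_cond_exp_le)
      show "(\<lambda>\<omega>. (c * \<Lambda> \<omega>)\<^sup>2) \<in> borel_measurable F" using \<Lambda>(1) by measurable
    qed (use le wF w0 we w\<Lambda>P in auto)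
    also have "\<dots> \<le> (\<integral>\<omega>. (c + t) / 2 * (\<Lambda> \<omega> + t) * (P \<omega>)\<^sup>2 \<partial>M)"
      using integral_mono[OF w\<Lambda>P \<Lambda>tP mult_right_mono[OF w\<Lambda>]] by simp
    finally have wle: "(\<integral>\<omega>. w \<omega> * (e \<omega>)\<^sup>2 \<partial>M) \<le> (\<integral>\<omega>. (c + t) / 2 * (\<Lambda> \<omega> + t) * (P \<omega>)\<^sup>2 \<partial>M)" .
    have "(\<integral>\<omega>. e \<omega> * P \<omega> \<partial>M) \<le> (\<integral>\<omega>. w \<omega> * (e \<omega>)\<^sup>2 + (c + t) / 2 * (\<Lambda> \<omega> + t) * (P \<omega>)\<^sup>2 \<partial>M)"
    proof (rule integral_mono)
      fix \<omega>
      define s where "s = (c + t) * (\<Lambda> \<omega> + t)"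
      have s: "0 < s" using ct pos[of \<omega>] by (simp add: s_def)
      have "0 \<le> (e \<omega> - s * P \<omega>)\<^sup>2 / (2 * s)" using s by simp
      also have "\<dots> = (e \<omega>)\<^sup>2 / (2 * s) + s / 2 * (P \<omega>)\<^sup>2 - e \<omega> * P \<omega>"
        using s by (simp add: power2_eq_square field_simps)
      finally show "e \<omega> * P \<omega> \<le> w \<omega> * (e \<omega>)\<^sup>2 + (c + t) / 2 * (\<Lambda> \<omega> + t) * (P \<omega>)\<^sup>2"
        unfolding w_def s_def mult.assoc by simp
    qed (use eP we \<Lambda>tP in auto)
    also have "\<dots> = (\<integral>\<omega>. w \<omega> * (e \<omega>)\<^sup>2 \<partial>M) + (\<integral>\<omega>. (c + t) / 2 * (\<Lambda> \<omega> + t) * (P \<omega>)\<^sup>2 \<partial>M)"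
      using we \<Lambda>tP by simp
    also have "\<dots> \<le> 2 * (\<integral>\<omega>. (c + t) / 2 * (\<Lambda> \<omega> + t) * (P \<omega>)\<^sup>2 \<partial>M)"
      using wle by simp
    also have "\<dots> = (c + t) * (?\<Lambda>P2 + t * ?P2)"
      using \<Lambda>P int by (simp add: distrib_right mult.assoc) (simp add: algebra_simps)
    also have "\<dots> = c * ?\<Lambda>P2 + t * (?\<Lambda>P2 + c * ?P2) + t * t * ?P2"
      by (simp add: algebra_simps)
    also have "\<dots> \<le> c * ?\<Lambda>P2 + t * (?\<Lambda>P2 + c * ?P2) + t * 1 * ?P2"
      using t P2 by (intro add_left_mono mult_right_mono mult_left_mono) auto
    also have "\<dots> = c * ?\<Lambda>P2 + t * (?\<Lambda>P2 + c * ?P2 + ?P2)"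
      by (simp add: algebra_simps)
    finally show "(\<integral>\<omega>. e \<omega> * P \<omega> \<partial>M) \<le> c * ?\<Lambda>P2 + t * (?\<Lambda>P2 + c * ?P2 + ?P2)" .
  qed
qed

text \<open>Young's inequality with exponents \<open>3/2\<close> and \<open>3\<close>.\<close>

lemma square_times_le_cubes:
  fixes a b :: real
  assumes "0 \<le> a" "0 \<le> b"
  shows "a\<^sup>2 * b \<le> 2 / 3 * a ^ 3 + 1 / 3 * b ^ 3"
proof -
  have "0 \<le> (a - b)\<^sup>2 * (2 * a + b)" using assms by simp
  then show ?thesis by (simp add: power2_eq_square power3_eq_cube algebra_simps)
qed

text \<open>Morally \<open>(1 - r) \<Lambda>\<close> is at most the conditional expectation of \<open>l\<close>, and the claim is then the
  conditional form of \<open>E(l) E(l\<^sup>2) \<le> E(l\<^sup>3)\<close>. The weight \<open>\<Lambda>\<^sup>2\<close> gives \<open>(1 - r) E(\<Lambda>\<^sup>3) \<le> E(\<Lambda>\<^sup>2 l)\<close>, so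
  Young's inequality yields \<open>E((1 - r)\<^sup>3 \<Lambda>\<^sup>3) \<le> E(l\<^sup>3)\<close>; a second use of it, with the roles of \<open>\<Lambda>\<close> and
  \<open>l\<close> exchanged, gives the result.\<close>

lemma (in finite_measure_subalgebra) third_moment_ge:
  fixes l \<Lambda> :: "'a \<Rightarrow> real"
  assumes le: "AE \<omega> in M. real_cond_exp M F (\<lambda>\<omega>. \<bar>l \<omega> - \<Lambda> \<omega>\<bar>) \<omega> \<le> r * \<Lambda> \<omega>"
    and r: "0 \<le> r" "r < 1"
    and \<Lambda>: "\<Lambda> \<in> borel_measurable F" "\<And>\<omega>. 0 \<le> \<Lambda> \<omega>" "\<And>\<omega>. \<Lambda> \<omega> \<le> K"
    and l [measurable]: "l \<in> borel_measurable M" and l0: "\<And>\<omega>. 0 \<le> l \<omega>"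
    and int: "integrable M (\<lambda>\<omega>. \<bar>l \<omega> - \<Lambda> \<omega>\<bar>)" "integrable M (\<lambda>\<omega>. l \<omega> ^ 3)"
  shows "(1 - r) * (\<integral>\<omega>. \<Lambda> \<omega> * (l \<omega>)\<^sup>2 \<partial>M) \<le> (\<integral>\<omega>. l \<omega> ^ 3 \<partial>M)"
proof -
  define c where "c = 1 - r"
  have c: "0 < c" using r by (simp add: c_def)
  have \<Lambda>M [measurable]: "\<Lambda> \<in> borel_measurable M"
    by (rule measurable_from_subalg[OF subalg \<Lambda>(1)])
  have \<Lambda>3: "integrable M (\<lambda>\<omega>. \<Lambda> \<omega> ^ 3)"
    by (rule integrable_const_bound[of _ "K ^ 3"]) (use \<Lambda> in \<open>auto intro!: power_mono\<close>)
  have \<Lambda>2d: "integrable M (\<lambda>\<omega>. (\<Lambda> \<omega>)\<^sup>2 * \<bar>l \<omega> - \<Lambda> \<omega>\<bar>)"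
    by (rule Bochner_Integration.integrable_bound[of _ "\<lambda>\<omega>. K\<^sup>2 * \<bar>l \<omega> - \<Lambda> \<omega>\<bar>"])
       (use int \<Lambda> in \<open>auto intro!: mult_right_mono power_mono\<close>)
  have cube: "(\<Lambda> \<omega>)\<^sup>2 * (r * \<Lambda> \<omega>) = r * \<Lambda> \<omega> ^ 3" for \<omega>
    by (simp add: power2_eq_square power3_eq_cube)
  have "(\<integral>\<omega>. (\<Lambda> \<omega>)\<^sup>2 * \<bar>l \<omega> - \<Lambda> \<omega>\<bar> \<partial>M)
      \<le> (\<integral>\<omega>. (\<Lambda> \<omega>)\<^sup>2 * 0 * 0 \<partial>M) + (\<integral>\<omega>. (\<Lambda> \<omega>)\<^sup>2 * (r * \<Lambda> \<omega>) \<partial>M)"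
  proof (rule weighted_integral_le_of_cond_exp_le)
    show "(\<lambda>\<omega>. (\<Lambda> \<omega>)\<^sup>2) \<in> borel_measurable F" using \<Lambda>(1) by measurable
  qed (use le \<Lambda>2d \<Lambda>3 in \<open>auto simp: cube\<close>)
  then have d: "(\<integral>\<omega>. (\<Lambda> \<omega>)\<^sup>2 * \<bar>l \<omega> - \<Lambda> \<omega>\<bar> \<partial>M) \<le> r * (\<integral>\<omega>. \<Lambda> \<omega> ^ 3 \<partial>M)"
    by (simp add: cube)
  have "(\<integral>\<omega>. c ^ 3 * \<Lambda> \<omega> ^ 3 \<partial>M) \<le> (\<integral>\<omega>. c\<^sup>2 * ((\<Lambda> \<omega>)\<^sup>2 * \<bar>l \<omega> - \<Lambda> \<omega>\<bar> - r * \<Lambda> \<omega> ^ 3)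
      + 2 / 3 * (c ^ 3 * \<Lambda> \<omega> ^ 3) + 1 / 3 * l \<omega> ^ 3 \<partial>M)"
  proof (rule integral_mono)
    fix \<omega>
    have "(\<Lambda> \<omega>)\<^sup>2 * (\<Lambda> \<omega> - l \<omega>) \<le> (\<Lambda> \<omega>)\<^sup>2 * \<bar>l \<omega> - \<Lambda> \<omega>\<bar>" by (rule mult_left_mono) auto
    from mult_left_mono[OF this, of "c\<^sup>2"]
    have "c\<^sup>2 * ((\<Lambda> \<omega>)\<^sup>2 * (\<Lambda> \<omega> - l \<omega>)) \<le> c\<^sup>2 * ((\<Lambda> \<omega>)\<^sup>2 * \<bar>l \<omega> - \<Lambda> \<omega>\<bar>)" by simp
    moreover have "(c * \<Lambda> \<omega>)\<^sup>2 * l \<omega> \<le> 2 / 3 * (c * \<Lambda> \<omega>) ^ 3 + 1 / 3 * l \<omega> ^ 3"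
      using c \<Lambda>(2)[of \<omega>] l0[of \<omega>] by (intro square_times_le_cubes) auto
    moreover have "c ^ 3 * \<Lambda> \<omega> ^ 3 = c\<^sup>2 * ((\<Lambda> \<omega>)\<^sup>2 * (\<Lambda> \<omega> - l \<omega>)) - c\<^sup>2 * (r * \<Lambda> \<omega> ^ 3)
        + (c * \<Lambda> \<omega>)\<^sup>2 * l \<omega>"
      by (simp add: c_def power2_eq_square power3_eq_cube algebra_simps)
    ultimately show "c ^ 3 * \<Lambda> \<omega> ^ 3 \<le> c\<^sup>2 * ((\<Lambda> \<omega>)\<^sup>2 * \<bar>l \<omega> - \<Lambda> \<omega>\<bar> - r * \<Lambda> \<omega> ^ 3)
      + 2 / 3 * (c ^ 3 * \<Lambda> \<omega> ^ 3) + 1 / 3 * l \<omega> ^ 3"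
      unfolding power_mult_distrib right_diff_distrib[of "c\<^sup>2" "(\<Lambda> \<omega>)\<^sup>2 * \<bar>l \<omega> - \<Lambda> \<omega>\<bar>"]
      by linarith
  qed (use \<Lambda>3 \<Lambda>2d int in auto)
  also have "\<dots> = c\<^sup>2 * ((\<integral>\<omega>. (\<Lambda> \<omega>)\<^sup>2 * \<bar>l \<omega> - \<Lambda> \<omega>\<bar> \<partial>M) - r * (\<integral>\<omega>. \<Lambda> \<omega> ^ 3 \<partial>M))
      + 2 / 3 * (c ^ 3 * (\<integral>\<omega>. \<Lambda> \<omega> ^ 3 \<partial>M)) + 1 / 3 * (\<integral>\<omega>. l \<omega> ^ 3 \<partial>M)"
    using \<Lambda>3 \<Lambda>2d int by simp
  also have "\<dots> \<le> 0 + 2 / 3 * (c ^ 3 * (\<integral>\<omega>. \<Lambda> \<omega> ^ 3 \<partial>M)) + 1 / 3 * (\<integral>\<omega>. l \<omega> ^ 3 \<partial>M)"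
    using d by (intro add_right_mono) (simp add: mult_nonneg_nonpos)
  finally have \<Lambda>3le: "c ^ 3 * (\<integral>\<omega>. \<Lambda> \<omega> ^ 3 \<partial>M) \<le> (\<integral>\<omega>. l \<omega> ^ 3 \<partial>M)" by simp
  have pt: "c * (\<Lambda> \<omega> * (l \<omega>)\<^sup>2) \<le> 1 / 3 * (c ^ 3 * \<Lambda> \<omega> ^ 3) + 2 / 3 * l \<omega> ^ 3" for \<omega>
    using square_times_le_cubes[of "l \<omega>" "c * \<Lambda> \<omega>"] c \<Lambda>(2)[of \<omega>] l0[of \<omega>]
    by (simp add: power_mult_distrib mult.commute mult.left_commute)
  have "integrable M (\<lambda>\<omega>. c * (\<Lambda> \<omega> * (l \<omega>)\<^sup>2))"
  proof (rule integrable_of_abs_le)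
    show "integrable M (\<lambda>\<omega>. 1 / 3 * (c ^ 3 * \<Lambda> \<omega> ^ 3) + 2 / 3 * l \<omega> ^ 3)"
      using \<Lambda>3 int by simp
    have "0 \<le> c * (\<Lambda> \<omega> * (l \<omega>)\<^sup>2)" for \<omega>
      using c \<Lambda>(2)[of \<omega>] by (intro mult_nonneg_nonneg) auto
    then show "\<bar>c * (\<Lambda> \<omega> * (l \<omega>)\<^sup>2)\<bar> \<le> 1 / 3 * (c ^ 3 * \<Lambda> \<omega> ^ 3) + 2 / 3 * l \<omega> ^ 3" for \<omega>
      using pt[of \<omega>] by simp
  qed measurable
  then have "(\<integral>\<omega>. c * (\<Lambda> \<omega> * (l \<omega>)\<^sup>2) \<partial>M)
      \<le> (\<integral>\<omega>. 1 / 3 * (c ^ 3 * \<Lambda> \<omega> ^ 3) + 2 / 3 * l \<omega> ^ 3 \<partial>M)"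
    by (rule integral_mono) (use \<Lambda>3 int pt in auto)
  also have "\<dots> = 1 / 3 * (c ^ 3 * (\<integral>\<omega>. \<Lambda> \<omega> ^ 3 \<partial>M)) + 2 / 3 * (\<integral>\<omega>. l \<omega> ^ 3 \<partial>M)"
    using \<Lambda>3 int by simp
  also have "\<dots> \<le> (\<integral>\<omega>. l \<omega> ^ 3 \<partial>M)" using \<Lambda>3le by simp
  finally show ?thesis by (simp add: c_def)
qed

lemma (in finite_measure_subalgebra) integral_le_of_relative_error:
  fixes l \<Lambda> :: "'a \<Rightarrow> real"
  assumes le: "AE \<omega> in M. real_cond_exp M F (\<lambda>\<omega>. \<bar>l \<omega> - \<Lambda> \<omega>\<bar>) \<omega> \<le> r * \<Lambda> \<omega>"
    and \<Lambda>: "integrable M \<Lambda>"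
    and int: "integrable M (\<lambda>\<omega>. \<bar>l \<omega> - \<Lambda> \<omega>\<bar>)" and l: "integrable M l"
  shows "(\<integral>\<omega>. l \<omega> \<partial>M) \<le> (1 + r) * (\<integral>\<omega>. \<Lambda> \<omega> \<partial>M)"
proof -
  have "(\<integral>\<omega>. \<bar>l \<omega> - \<Lambda> \<omega>\<bar> \<partial>M) = (\<integral>\<omega>. real_cond_exp M F (\<lambda>\<omega>. \<bar>l \<omega> - \<Lambda> \<omega>\<bar>) \<omega> \<partial>M)"
    using real_cond_exp_int[OF int] by simp
  also have "\<dots> \<le> (\<integral>\<omega>. r * \<Lambda> \<omega> \<partial>M)"
    by (rule integral_mono_AE) (use real_cond_exp_int[OF int] \<Lambda> le in auto)
  finally have "(\<integral>\<omega>. \<bar>l \<omega> - \<Lambda> \<omega>\<bar> \<partial>M) \<le> r * (\<integral>\<omega>. \<Lambda> \<omega> \<partial>M)" by simp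
  moreover have "(\<integral>\<omega>. l \<omega> \<partial>M) \<le> (\<integral>\<omega>. \<Lambda> \<omega> + \<bar>l \<omega> - \<Lambda> \<omega>\<bar> \<partial>M)"
    by (rule integral_mono) (use \<Lambda> int l in auto)
  ultimately show ?thesis using \<Lambda> int by (simp add: algebra_simps)
qed

section \<open>One iteration in expectation\<close>

lemma (in finite_measure) integrable_of_square_integrable:
  fixes X :: "'a \<Rightarrow> 'b::euclidean_space"
  assumes [measurable]: "X \<in> borel_measurable M"
    and int: "integrable M (\<lambda>\<omega>. (norm (X \<omega>))\<^sup>2)"
  shows "integrable M (\<lambda>\<omega>. norm (X \<omega>))"
proof (rule integrable_of_abs_le)
  show "integrable M (\<lambda>\<omega>. 1 + (norm (X \<omega>))\<^sup>2)" using int by simp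
  fix \<omega>
  have "0 \<le> (norm (X \<omega>) - 1)\<^sup>2" by simp
  then show "\<bar>norm (X \<omega>)\<bar> \<le> 1 + (norm (X \<omega>))\<^sup>2"
    by (simp add: power2_diff) (smt (verit) norm_ge_zero)
qed measurable

lemma inner_integrable_of_square_integrable:
  fixes X Y :: "'a \<Rightarrow> 'b::euclidean_space"
  assumes [measurable]: "X \<in> borel_measurable M" "Y \<in> borel_measurable M"
    and int: "integrable M (\<lambda>\<omega>. (norm (X \<omega>))\<^sup>2)" "integrable M (\<lambda>\<omega>. (norm (Y \<omega>))\<^sup>2)"
  shows "integrable M (\<lambda>\<omega>. X \<omega> \<bullet> Y \<omega>)"
proof (rule integrable_of_abs_le)
  show "integrable M (\<lambda>\<omega>. (norm (X \<omega>))\<^sup>2 + (norm (Y \<omega>))\<^sup>2)" using int by simp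
  fix \<omega>
  have "\<bar>X \<omega> \<bullet> Y \<omega>\<bar> \<le> norm (X \<omega>) * norm (Y \<omega>)" by (rule Cauchy_Schwarz_ineq2)
  moreover have "0 \<le> norm (X \<omega>) * norm (Y \<omega>)" by simp
  moreover have "2 * norm (X \<omega>) * norm (Y \<omega>) \<le> (norm (X \<omega>))\<^sup>2 + (norm (Y \<omega>))\<^sup>2"
    by (rule sum_squares_bound)
  ultimately show "\<bar>X \<omega> \<bullet> Y \<omega>\<bar> \<le> (norm (X \<omega>))\<^sup>2 + (norm (Y \<omega>))\<^sup>2" by linarith
qed measurable

lemma norm_add_square_le:
  fixes a b :: "'a::real_normed_vector"
  shows "(norm (a + b))\<^sup>2 \<le> 2 * (norm a)\<^sup>2 + 2 * (norm b)\<^sup>2"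
proof -
  have "(norm (a + b))\<^sup>2 \<le> (norm a + norm b)\<^sup>2"
    by (intro power_mono norm_triangle_ineq) simp
  moreover have "2 * norm a * norm b \<le> (norm a)\<^sup>2 + (norm b)\<^sup>2"
    by (rule sum_squares_bound)
  ultimately show ?thesis by (simp add: power2_sum)
qed

lemma square_integrable_add_scaleR:
  fixes X Y :: "'a \<Rightarrow> 'b::euclidean_space"
  assumes [measurable]: "X \<in> borel_measurable M" "Y \<in> borel_measurable M"
    and int: "integrable M (\<lambda>\<omega>. (norm (X \<omega>))\<^sup>2)" "integrable M (\<lambda>\<omega>. (norm (Y \<omega>))\<^sup>2)"
  shows "integrable M (\<lambda>\<omega>. (norm (X \<omega> + c *\<^sub>R Y \<omega>))\<^sup>2)"
proof (rule integrable_of_abs_le)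
  show "integrable M (\<lambda>\<omega>. 2 * (norm (X \<omega>))\<^sup>2 + 2 * c\<^sup>2 * (norm (Y \<omega>))\<^sup>2)" using int by simp
  show "\<bar>(norm (X \<omega> + c *\<^sub>R Y \<omega>))\<^sup>2\<bar> \<le> 2 * (norm (X \<omega>))\<^sup>2 + 2 * c\<^sup>2 * (norm (Y \<omega>))\<^sup>2" for \<omega>
    using norm_add_square_le[of "X \<omega>" "c *\<^sub>R Y \<omega>"] by (simp add: power_mult_distrib)
qed measurable

lemma (in prob_space) integral_le_of_cond_exp_le:
  assumes sub: "subalgebra M F"
    and int: "integrable M X" "integrable M Y"
    and le: "AE \<omega> in M. real_cond_exp M F X \<omega> \<le> a * real_cond_exp M F Y \<omega> + b"
  shows "(\<integral>\<omega>. X \<omega> \<partial>M) \<le> a * (\<integral>\<omega>. Y \<omega> \<partial>M) + b"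
proof -
  interpret finite_measure_subalgebra M F by unfold_locales (rule sub)
  have "(\<integral>\<omega>. 1 * X \<omega> \<partial>M) \<le> (\<integral>\<omega>. 1 * a * Y \<omega> \<partial>M) + (\<integral>\<omega>. 1 * b \<partial>M)"
    by (rule weighted_integral_le_of_cond_exp_le) (use int le in auto)
  then show ?thesis using int by (simp add: prob_space)
qed

text \<open>The sign of \<open>p\<close> makes \<open>g \<bullet> p = - \<bar>g \<bullet> q\<bar>\<close>. Replacing the estimate \<open>g\<close> by the gradient \<open>G\<close> costs
  at most \<open>\<bar>(g - G) \<bullet> q\<bar>\<close>, whose expectation exceeds that of \<open>\<theta>\<^sup>2 \<bar>g \<bullet> q\<bar>\<close> by no more than \<open>\<sigma>\<^sup>2\<close>; because
  \<open>\<theta> \<le> 1\<close>, the terms in \<open>\<bar>g \<bullet> q\<bar>\<close> cancel favourably.\<close>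

lemma (in prob_space) integral_gradient_times_step_le:
  fixes G g q p :: "'a \<Rightarrow> real^'n"
  assumes sub: "subalgebra M F"
    and meas [measurable]: "G \<in> borel_measurable M" "p \<in> borel_measurable M"
    and p: "\<And>\<omega>. \<omega> \<in> space M \<Longrightarrow> p \<omega> = (if g \<omega> \<bullet> q \<omega> \<le> 0 then q \<omega> else - q \<omega>)"
    and \<theta>: "0 \<le> \<theta>" "\<theta> \<le> 1"
    and int: "integrable M (\<lambda>\<omega>. \<bar>(g \<omega> - G \<omega>) \<bullet> q \<omega>\<bar>)" "integrable M (\<lambda>\<omega>. \<bar>g \<omega> \<bullet> q \<omega>\<bar>)"
    and le: "AE \<omega> in M. real_cond_exp M F (\<lambda>\<omega>. \<bar>(g \<omega> - G \<omega>) \<bullet> q \<omega>\<bar>) \<omega>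
      \<le> \<theta>\<^sup>2 * real_cond_exp M F (\<lambda>\<omega>. \<bar>g \<omega> \<bullet> q \<omega>\<bar>) \<omega> + \<sigma>\<^sup>2"
  shows "integrable M (\<lambda>\<omega>. G \<omega> \<bullet> p \<omega>)" "(\<integral>\<omega>. G \<omega> \<bullet> p \<omega> \<partial>M) \<le> \<sigma>\<^sup>2"
proof -
  let ?N = "\<lambda>\<omega>. \<bar>(g \<omega> - G \<omega>) \<bullet> q \<omega>\<bar>" and ?Q = "\<lambda>\<omega>. \<bar>g \<omega> \<bullet> q \<omega>\<bar>"
  have abs: "\<bar>G \<omega> \<bullet> p \<omega>\<bar> \<le> ?N \<omega> + ?Q \<omega>" and up: "G \<omega> \<bullet> p \<omega> \<le> ?N \<omega> - ?Q \<omega>"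
    if "\<omega> \<in> space M" for \<omega>
    using p[OF that] by (auto simp: inner_diff_left)
  show Gp: "integrable M (\<lambda>\<omega>. G \<omega> \<bullet> p \<omega>)"
    by (rule integrable_of_abs_le[OF Bochner_Integration.integrable_add[OF int]])
       (measurable, rule abs)
  have "(\<integral>\<omega>. G \<omega> \<bullet> p \<omega> \<partial>M) \<le> (\<integral>\<omega>. ?N \<omega> - ?Q \<omega> \<partial>M)"
    by (rule integral_mono[OF Gp]) (use int up in auto)
  also have "\<dots> = (\<integral>\<omega>. ?N \<omega> \<partial>M) - (\<integral>\<omega>. ?Q \<omega> \<partial>M)" using int by simp
  also have "\<dots> \<le> \<sigma>\<^sup>2"
  proof -
    have "(\<integral>\<omega>. ?N \<omega> \<partial>M) \<le> \<theta>\<^sup>2 * (\<integral>\<omega>. ?Q \<omega> \<partial>M) + \<sigma>\<^sup>2"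
      by (rule integral_le_of_cond_exp_le[OF sub int le])
    moreover have "\<theta>\<^sup>2 * (\<integral>\<omega>. ?Q \<omega> \<partial>M) \<le> 1 * (\<integral>\<omega>. ?Q \<omega> \<partial>M)"
      using \<theta> by (intro mult_right_mono) (auto simp: power_le_one)
    ultimately show ?thesis by linarith
  qed
  finally show "(\<integral>\<omega>. G \<omega> \<bullet> p \<omega> \<partial>M) \<le> \<sigma>\<^sup>2" .
qed

context smooth_objective
begin

lemma f_integrable:
  assumes "prob_space M" and X [measurable]: "X \<in> borel_measurable M"
    and int: "integrable M (\<lambda>\<omega>. (norm (X \<omega>))\<^sup>2)"
  shows "integrable M (\<lambda>\<omega>. f (X \<omega>))"
proof -
  interpret prob_space M by fact
  let ?v = "\<lambda>\<omega>. \<bar>fbar\<bar> + \<bar>f 0\<bar> + \<bar>gradf 0 \<bullet> X \<omega>\<bar> + L\<^sub>g / 2 * (norm (X \<omega>))\<^sup>2"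
  show ?thesis
  proof (rule integrable_of_abs_le)
    have "integrable M (\<lambda>\<omega>. gradf 0 \<bullet> X \<omega>)"
      by (rule inner_integrable_of_square_integrable) (use int in auto)
    then show "integrable M ?v" using int by simp
    show "\<bar>f (X \<omega>)\<bar> \<le> ?v \<omega>" for \<omega>
    proof -
      have "0 \<le> L\<^sub>g / 2 * (norm (X \<omega>))\<^sup>2" using L_pos by simp
      then show ?thesis
        using f_upper_quadratic[of 0 "X \<omega>"] bounded_below[of "X \<omega>"] by auto
    qed
  qed measurable
qed

lemma gradf_square_integrable:
  assumes "prob_space M" and X [measurable]: "X \<in> borel_measurable M"
    and int: "integrable M (\<lambda>\<omega>. (norm (X \<omega>))\<^sup>2)"
  shows "integrable M (\<lambda>\<omega>. (norm (gradf (X \<omega>)))\<^sup>2)"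
proof -
  interpret prob_space M by fact
  show ?thesis
  proof (rule integrable_of_abs_le)
    show "integrable M (\<lambda>\<omega>. 2 * (norm (gradf 0))\<^sup>2 + 2 * (L\<^sub>g\<^sup>2 * (norm (X \<omega>))\<^sup>2))"
      using int by simp
    show "\<bar>(norm (gradf (X \<omega>)))\<^sup>2\<bar> \<le> 2 * (norm (gradf 0))\<^sup>2 + 2 * (L\<^sub>g\<^sup>2 * (norm (X \<omega>))\<^sup>2)" for \<omega>
    proof -
      have "(norm (gradf (X \<omega>) - gradf 0))\<^sup>2 \<le> (L\<^sub>g * norm (X \<omega>))\<^sup>2"
        using grad_lipschitz[of "X \<omega>" 0] by (intro power_mono) auto
      then show ?thesis
        using norm_add_square_le[of "gradf 0" "gradf (X \<omega>) - gradf 0"]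
        by (simp add: power_mult_distrib)
    qed
  qed measurable
qed

text \<open>The step along a direction of negative curvature. The cubic Taylor bound leaves the term
  \<open>- \<gamma> \<delta>\<^sup>2 l\<^sup>3\<close>, a fraction \<open>\<gamma>\<^sub>H / (1 - \<gamma>\<^sub>l)\<close> of \<open>\<delta>\<^sup>2 l\<^sup>3\<close> is spent on the error of the Hessian estimate, and
  the bound on \<open>\<beta>\<close> makes the cubic remainder at most half of what is left. The second claim bounds
  the mean step length: \<open>\<Lambda>\<close> never exceeds \<open>L\<^sub>g\<close>, and \<open>l\<close> exceeds \<open>\<Lambda>\<close> by at most the relative error
  \<open>\<gamma>\<^sub>l\<close> in the mean.\<close>

lemma curvature_step_decrease:
  fixes X p :: "'w \<Rightarrow> real^'n" and H :: "'w \<Rightarrow> real^'n^'n"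
  assumes "prob_space M" and sub: "subalgebra M F"
    and XF: "X \<in> borel_measurable F" and p [measurable]: "p \<in> borel_measurable M"
    and X2: "integrable M (\<lambda>\<omega>. (norm (X \<omega>))\<^sup>2)"
    and params: "0 < \<gamma>" "0 \<le> \<gamma>\<^sub>H" "0 \<le> \<gamma>\<^sub>l" "\<gamma>\<^sub>l < 1" "0 < \<delta>"
    and \<beta>: "0 < \<beta>" "\<beta> \<le> 3 * (\<gamma> - \<gamma>\<^sub>H / (1 - \<gamma>\<^sub>l)) / (2 * \<delta> * L\<^sub>H)"
    and norm_p: "\<And>\<omega>. \<omega> \<in> space M \<Longrightarrow> norm (p \<omega>) = \<delta> * \<bar>lambda_min_neg (H \<omega>)\<bar>"
    and curv: "\<And>\<omega>. \<omega> \<in> space M \<Longrightarrow>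
      p \<omega> \<bullet> (H \<omega> *v p \<omega>) \<le> \<gamma> * lambda_min_neg (H \<omega>) * (norm (p \<omega>))\<^sup>2"
    and slope: "integrable M (\<lambda>\<omega>. gradf (X \<omega>) \<bullet> p \<omega>)"
      "(\<integral>\<omega>. gradf (X \<omega>) \<bullet> p \<omega> \<partial>M) \<le> \<sigma>\<^sup>2"
    and int: "integrable M (\<lambda>\<omega>. (norm ((H \<omega> - hessf (X \<omega>)) *v p \<omega>))\<^sup>2)"
      "integrable M (\<lambda>\<omega>. (norm (p \<omega>))\<^sup>2)"
      "integrable M (\<lambda>\<omega>. \<bar>lambda_min_neg (H \<omega>) - lambda_min_neg (hessf (X \<omega>))\<bar>)"
    and hess_err: "AE \<omega> in M.
      real_cond_exp M F (\<lambda>\<omega>. (norm ((H \<omega> - hessf (X \<omega>)) *v p \<omega>))\<^sup>2) \<omega>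
      \<le> \<gamma>\<^sub>H\<^sup>2 * \<bar>lambda_min_neg (hessf (X \<omega>))\<bar>\<^sup>2 * real_cond_exp M F (\<lambda>\<omega>. (norm (p \<omega>))\<^sup>2) \<omega>"
    and eig_err: "AE \<omega> in M.
      real_cond_exp M F (\<lambda>\<omega>. \<bar>lambda_min_neg (H \<omega>) - lambda_min_neg (hessf (X \<omega>))\<bar>) \<omega>
      \<le> \<gamma>\<^sub>l * \<bar>lambda_min_neg (hessf (X \<omega>))\<bar>"
  shows "(\<integral>\<omega>. f (X \<omega> + \<beta> *\<^sub>R p \<omega>) \<partial>M) \<le> (\<integral>\<omega>. f (X \<omega>) \<partial>M) + \<beta> * \<sigma>\<^sup>2"
    and "(\<integral>\<omega>. norm (p \<omega>) \<partial>M) \<le> \<delta> * ((1 + \<gamma>\<^sub>l) * L\<^sub>g)"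
proof -
  interpret prob_space M by fact
  interpret finite_measure_subalgebra M F by unfold_locales (rule sub)
  have X [measurable]: "X \<in> borel_measurable M" by (rule measurable_from_subalg[OF sub XF])
  define \<Lambda> where "\<Lambda> \<omega> = \<bar>lambda_min_neg (hessf (X \<omega>))\<bar>" for \<omega>
  define l where "l \<omega> = norm (p \<omega>) / \<delta>" for \<omega>
  define e where "e \<omega> = norm ((H \<omega> - hessf (X \<omega>)) *v p \<omega>)" for \<omega>
  have neg: "lambda_min_neg A \<le> 0" for A :: "real^'n^'n" by (simp add: lambda_min_neg_def)
  have \<Lambda>F: "\<Lambda> \<in> borel_measurable F" unfolding \<Lambda>_def using XF by measurable
  have \<Lambda>M [measurable]: "\<Lambda> \<in> borel_measurable M" by (rule measurable_from_subalg[OF sub \<Lambda>F])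
  have \<Lambda>0: "0 \<le> \<Lambda> \<omega>" and \<Lambda>L: "\<Lambda> \<omega> \<le> L\<^sub>g" for \<omega>
    using lambda_min_neg_hess_bounded by (auto simp: \<Lambda>_def)
  have \<Lambda>int: "integrable M \<Lambda>"
    by (rule integrable_const_bound[of _ L\<^sub>g]) (use \<Lambda>0 \<Lambda>L in auto)
  have l [measurable]: "l \<in> borel_measurable M" unfolding l_def by measurable
  have l0: "0 \<le> l \<omega>" for \<omega> using params by (simp add: l_def)
  have P: "norm (p \<omega>) = \<delta> * l \<omega>" for \<omega> using params by (simp add: l_def)
  have lH: "lambda_min_neg (H \<omega>) = - l \<omega>" if "\<omega> \<in> space M" for \<omega>
    using norm_p[OF that] params neg[of "H \<omega>"] by (simp add: l_def)
  have diff: "\<bar>lambda_min_neg (H \<omega>) - lambda_min_neg (hessf (X \<omega>))\<bar> = \<bar>l \<omega> - \<Lambda> \<omega>\<bar>"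
    if "\<omega> \<in> space M" for \<omega>
    using lH[OF that] neg[of "hessf (X \<omega>)"] by (simp add: \<Lambda>_def)
  have dint: "integrable M (\<lambda>\<omega>. \<bar>l \<omega> - \<Lambda> \<omega>\<bar>)"
    using int(3) by (subst (asm) Bochner_Integration.integrable_cong[OF refl diff]) auto
  have dle: "AE \<omega> in M. real_cond_exp M F (\<lambda>\<omega>. \<bar>l \<omega> - \<Lambda> \<omega>\<bar>) \<omega> \<le> \<gamma>\<^sub>l * \<Lambda> \<omega>"
  proof -
    have "AE \<omega> in M. real_cond_exp M F (\<lambda>\<omega>. \<bar>lambda_min_neg (H \<omega>) - lambda_min_neg (hessf (X \<omega>))\<bar>) \<omega>
        = real_cond_exp M F (\<lambda>\<omega>. \<bar>l \<omega> - \<Lambda> \<omega>\<bar>) \<omega>"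
      by (rule real_cond_exp_cong) (use diff int(3) in \<open>auto intro!: AE_I2\<close>)
    with eig_err show ?thesis by eventually_elim (simp add: \<Lambda>_def)
  qed
  have Pint: "integrable M (\<lambda>\<omega>. norm (p \<omega>))"
    by (rule integrable_of_square_integrable[OF p int(2)])
  then have lint: "integrable M l" unfolding l_def by simp
  have "(\<integral>\<omega>. l \<omega> \<partial>M) \<le> (1 + \<gamma>\<^sub>l) * (\<integral>\<omega>. \<Lambda> \<omega> \<partial>M)"
    by (rule integral_le_of_relative_error[OF dle \<Lambda>int dint lint])
  also have "\<dots> \<le> (1 + \<gamma>\<^sub>l) * L\<^sub>g"
    using integral_le_const[OF \<Lambda>int, of L\<^sub>g] \<Lambda>L params by (intro mult_left_mono) auto
  finally show "(\<integral>\<omega>. norm (p \<omega>) \<partial>M) \<le> \<delta> * ((1 + \<gamma>\<^sub>l) * L\<^sub>g)"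
    using params by (simp add: P)
  \<comment> \<open>Integrability of \<open>e\<^sup>2\<close> already contains the measurability of \<open>e\<close>.\<close>
  have e [measurable]: "e \<in> borel_measurable M"
  proof -
    have "e = (\<lambda>\<omega>. sqrt ((norm ((H \<omega> - hessf (X \<omega>)) *v p \<omega>))\<^sup>2))"
      by (simp add: e_def fun_eq_iff)
    then show ?thesis
      using measurable_compose[OF borel_measurable_integrable[OF int(1)] borel_measurable_sqrt] by simp
  qed
  have e2: "integrable M (\<lambda>\<omega>. (e \<omega>)\<^sup>2)" using int(1) by (simp add: e_def)
  have ele: "AE \<omega> in M. real_cond_exp M F (\<lambda>\<omega>. (e \<omega>)\<^sup>2) \<omega>
      \<le> (\<gamma>\<^sub>H * \<Lambda> \<omega>)\<^sup>2 * real_cond_exp M F (\<lambda>\<omega>. (norm (p \<omega>))\<^sup>2) \<omega>"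
    using hess_err by (simp add: e_def \<Lambda>_def power_mult_distrib)
  note eP = integral_error_times_step_le[OF ele params(2) \<Lambda>F \<Lambda>0 \<Lambda>L e _ e2 int(2)]
  have ePint: "integrable M (\<lambda>\<omega>. e \<omega> * norm (p \<omega>))" by (rule eP) measurable
  have ePle: "(\<integral>\<omega>. e \<omega> * norm (p \<omega>) \<partial>M) \<le> \<gamma>\<^sub>H * (\<integral>\<omega>. \<Lambda> \<omega> * (norm (p \<omega>))\<^sup>2 \<partial>M)"
    by (rule eP) measurable
  have form: "p \<omega> \<bullet> (hessf (X \<omega>) *v p \<omega>) \<le> e \<omega> * norm (p \<omega>) - \<gamma> * \<delta>\<^sup>2 * l \<omega> ^ 3"
    if "\<omega> \<in> space M" for \<omega>
  proof -
    have "p \<omega> \<bullet> (hessf (X \<omega>) *v p \<omega>)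
        = p \<omega> \<bullet> (H \<omega> *v p \<omega>) - p \<omega> \<bullet> ((H \<omega> - hessf (X \<omega>)) *v p \<omega>)"
      by (simp add: matrix_vector_mult_diff_rdistrib inner_diff_right)
    moreover have "\<bar>p \<omega> \<bullet> ((H \<omega> - hessf (X \<omega>)) *v p \<omega>)\<bar> \<le> norm (p \<omega>) * e \<omega>"
      unfolding e_def by (rule Cauchy_Schwarz_ineq2)
    moreover have "\<gamma> * lambda_min_neg (H \<omega>) * (norm (p \<omega>))\<^sup>2 = - (\<gamma> * \<delta>\<^sup>2 * l \<omega> ^ 3)"
      by (simp add: lH[OF that] P power_mult_distrib power2_eq_square power3_eq_cube)
    ultimately show ?thesis using curv[OF that] by (simp add: mult.commute)
  qed
  \<comment> \<open>Only second moments of the step are assumed finite. The third moment is finite because the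
    true curvature along \<open>p\<close> is at least \<open>- L\<^sub>g \<parallel>p\<parallel>\<^sup>2\<close>, which limits how negative the estimated one can be.\<close>
  have l3: "integrable M (\<lambda>\<omega>. l \<omega> ^ 3)"
  proof (rule integrable_of_abs_le)
    show "integrable M (\<lambda>\<omega>. (1 / (\<gamma> * \<delta>\<^sup>2)) * (e \<omega> * norm (p \<omega>) + L\<^sub>g * (norm (p \<omega>))\<^sup>2))"
      using ePint int(2) by (intro integrable_mult_right) simp
    fix \<omega> assume \<omega>: "\<omega> \<in> space M"
    have "\<bar>p \<omega> \<bullet> (hessf (X \<omega>) *v p \<omega>)\<bar> \<le> norm (p \<omega>) * norm (hessf (X \<omega>) *v p \<omega>)"
      by (rule Cauchy_Schwarz_ineq2)
    also have "\<dots> \<le> norm (p \<omega>) * (L\<^sub>g * norm (p \<omega>))"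
      by (rule mult_left_mono[OF norm_hess_vec_le]) simp
    finally have "\<gamma> * \<delta>\<^sup>2 * l \<omega> ^ 3 \<le> e \<omega> * norm (p \<omega>) + L\<^sub>g * (norm (p \<omega>))\<^sup>2"
      using form[OF \<omega>] by (simp add: power2_eq_square mult.commute mult.left_commute)
    then show "\<bar>l \<omega> ^ 3\<bar> \<le> (1 / (\<gamma> * \<delta>\<^sup>2)) * (e \<omega> * norm (p \<omega>) + L\<^sub>g * (norm (p \<omega>))\<^sup>2)"
      using params l0[of \<omega>] by (simp add: pos_le_divide_eq mult.commute)
  qed measurable
  let ?l3 = "\<integral>\<omega>. l \<omega> ^ 3 \<partial>M"
  have l30: "0 \<le> ?l3" using l0 by simp
  have "(1 - \<gamma>\<^sub>l) * (\<integral>\<omega>. \<Lambda> \<omega> * (l \<omega>)\<^sup>2 \<partial>M) \<le> ?l3"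
    by (rule third_moment_ge[OF dle params(3,4) \<Lambda>F \<Lambda>0 \<Lambda>L l l0 dint l3])
  then have \<Lambda>l: "(\<integral>\<omega>. \<Lambda> \<omega> * (l \<omega>)\<^sup>2 \<partial>M) \<le> ?l3 / (1 - \<gamma>\<^sub>l)"
    using params by (simp add: pos_le_divide_eq mult.commute)
  have "(\<integral>\<omega>. \<Lambda> \<omega> * (norm (p \<omega>))\<^sup>2 \<partial>M) = \<delta>\<^sup>2 * (\<integral>\<omega>. \<Lambda> \<omega> * (l \<omega>)\<^sup>2 \<partial>M)"
    by (subst integral_mult_right_zero[symmetric]) (simp add: P power_mult_distrib mult.left_commute)
  then have ePle': "(\<integral>\<omega>. e \<omega> * norm (p \<omega>) \<partial>M) \<le> \<gamma>\<^sub>H * (\<delta>\<^sup>2 * (?l3 / (1 - \<gamma>\<^sub>l)))"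
    using ePle \<Lambda>l params(2) by (smt (verit) mult_left_mono zero_le_power2)
  define \<Gamma> where "\<Gamma> = \<gamma> - \<gamma>\<^sub>H / (1 - \<gamma>\<^sub>l)"
  have \<beta>\<Gamma>: "L\<^sub>H * \<beta> * \<delta> / 3 \<le> \<Gamma> / 2"
    using \<beta>(2) L_pos params by (simp add: \<Gamma>_def[symmetric] pos_le_divide_eq algebra_simps)
  have fX: "integrable M (\<lambda>\<omega>. f (X \<omega>))"
    by (rule f_integrable[OF \<open>prob_space M\<close> X X2])
  have fXp: "integrable M (\<lambda>\<omega>. f (X \<omega> + \<beta> *\<^sub>R p \<omega>))"
    by (rule f_integrable[OF \<open>prob_space M\<close> _ square_integrable_add_scaleR[OF X p X2 int(2)]]) measurable
  have "(\<integral>\<omega>. f (X \<omega> + \<beta> *\<^sub>R p \<omega>) \<partial>M)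
      \<le> (\<integral>\<omega>. f (X \<omega>) + \<beta> * (gradf (X \<omega>) \<bullet> p \<omega>)
          + \<beta>\<^sup>2 / 2 * (e \<omega> * norm (p \<omega>) - \<gamma> * \<delta>\<^sup>2 * l \<omega> ^ 3)
          + L\<^sub>H * \<beta> ^ 3 * \<delta> ^ 3 / 6 * l \<omega> ^ 3 \<partial>M)"
  proof (rule integral_mono[OF fXp])
    fix \<omega> assume \<omega>: "\<omega> \<in> space M"
    have "f (X \<omega> + \<beta> *\<^sub>R p \<omega>) \<le> f (X \<omega>) + \<beta> * (gradf (X \<omega>) \<bullet> p \<omega>)
        + \<beta>\<^sup>2 / 2 * (p \<omega> \<bullet> (hessf (X \<omega>) *v p \<omega>)) + L\<^sub>H * \<beta> ^ 3 * \<delta> ^ 3 / 6 * l \<omega> ^ 3"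
      using f_upper_cubic[of "X \<omega>" "\<beta> *\<^sub>R p \<omega>"] \<beta>(1)
      by (simp add: matrix_vector_mult_scaleR P power2_eq_square power3_eq_cube
          mult.commute mult.left_commute)
    moreover have "\<beta>\<^sup>2 / 2 * (p \<omega> \<bullet> (hessf (X \<omega>) *v p \<omega>))
        \<le> \<beta>\<^sup>2 / 2 * (e \<omega> * norm (p \<omega>) - \<gamma> * \<delta>\<^sup>2 * l \<omega> ^ 3)"
      by (rule mult_left_mono[OF form[OF \<omega>]]) simp
    ultimately show "f (X \<omega> + \<beta> *\<^sub>R p \<omega>) \<le> f (X \<omega>) + \<beta> * (gradf (X \<omega>) \<bullet> p \<omega>)
          + \<beta>\<^sup>2 / 2 * (e \<omega> * norm (p \<omega>) - \<gamma> * \<delta>\<^sup>2 * l \<omega> ^ 3)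
          + L\<^sub>H * \<beta> ^ 3 * \<delta> ^ 3 / 6 * l \<omega> ^ 3" by linarith
  qed (use fX slope ePint l3 in auto)
  also have "\<dots> = (\<integral>\<omega>. f (X \<omega>) \<partial>M) + \<beta> * (\<integral>\<omega>. gradf (X \<omega>) \<bullet> p \<omega> \<partial>M)
          + \<beta>\<^sup>2 / 2 * ((\<integral>\<omega>. e \<omega> * norm (p \<omega>) \<partial>M) - \<gamma> * \<delta>\<^sup>2 * ?l3)
          + L\<^sub>H * \<beta> ^ 3 * \<delta> ^ 3 / 6 * ?l3"
    using fX slope ePint l3 by simp
  also have "\<dots> \<le> (\<integral>\<omega>. f (X \<omega>) \<partial>M) + \<beta> * \<sigma>\<^sup>2
          + \<beta>\<^sup>2 / 2 * (\<gamma>\<^sub>H * (\<delta>\<^sup>2 * (?l3 / (1 - \<gamma>\<^sub>l))) - \<gamma> * \<delta>\<^sup>2 * ?l3)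
          + L\<^sub>H * \<beta> ^ 3 * \<delta> ^ 3 / 6 * ?l3"
    using slope(2) ePle' \<beta>(1) by (intro add_right_mono add_mono mult_left_mono diff_right_mono) auto
  also have "\<dots> = (\<integral>\<omega>. f (X \<omega>) \<partial>M) + \<beta> * \<sigma>\<^sup>2
          + \<beta>\<^sup>2 / 2 * \<delta>\<^sup>2 * ?l3 * (L\<^sub>H * \<beta> * \<delta> / 3 - \<Gamma>)"
    unfolding \<Gamma>_def using params(4) by (simp add: power2_eq_square power3_eq_cube) (simp add: field_simps)
  also have "\<dots> \<le> (\<integral>\<omega>. f (X \<omega>) \<partial>M) + \<beta> * \<sigma>\<^sup>2"
  proof -
    have "0 \<le> L\<^sub>H * \<beta> * \<delta> / 3" using L_pos \<beta>(1) params by simp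
    then have "L\<^sub>H * \<beta> * \<delta> / 3 - \<Gamma> \<le> 0" using \<beta>\<Gamma> by linarith
    then have "\<beta>\<^sup>2 / 2 * \<delta>\<^sup>2 * ?l3 * (L\<^sub>H * \<beta> * \<delta> / 3 - \<Gamma>) \<le> 0"
      using l30 by (intro mult_nonneg_nonpos) auto
    then show ?thesis by simp
  qed
  finally show "(\<integral>\<omega>. f (X \<omega> + \<beta> *\<^sub>R p \<omega>) \<partial>M) \<le> (\<integral>\<omega>. f (X \<omega>) \<partial>M) + \<beta> * \<sigma>\<^sup>2" .
qed

text \<open>Since \<open>g\<close> is unbiased, both \<open>E(\<nabla>f(Y) \<bullet> g) = E \<parallel>\<nabla>f(Y)\<parallel>\<^sup>2\<close> and
  \<open>E \<parallel>g\<parallel>\<^sup>2 = E \<parallel>g - \<nabla>f(Y)\<parallel>\<^sup>2 + E \<parallel>\<nabla>f(Y)\<parallel>\<^sup>2\<close> hold. The bound on \<open>\<alpha>\<close> lets half of the first order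
  decrease absorb the part of the second order term that is proportional to the squared gradient.\<close>

lemma gradient_step_decrease:
  fixes Y g :: "'w \<Rightarrow> real^'n"
  assumes "prob_space M" and sub: "subalgebra M F"
    and YF: "Y \<in> borel_measurable F" and g [measurable]: "g \<in> borel_measurable M"
    and Y2: "integrable M (\<lambda>\<omega>. (norm (Y \<omega>))\<^sup>2)"
    and N2: "integrable M (\<lambda>\<omega>. (norm (g \<omega> - gradf (Y \<omega>)))\<^sup>2)"
    and unbiased: "AE \<omega> in M. vec_cond_exp M F g \<omega> = gradf (Y \<omega>)"
    and var: "AE \<omega> in M. real_cond_exp M F (\<lambda>\<omega>. (norm (g \<omega> - gradf (Y \<omega>)))\<^sup>2) \<omega>
      \<le> \<theta>\<^sup>2 * (norm (gradf (Y \<omega>)))\<^sup>2 + \<sigma>\<^sup>2"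
    and \<alpha>: "0 < \<alpha>" "\<alpha> \<le> 1 / (L\<^sub>g * (1 + \<theta>\<^sup>2))"
  shows "integrable M (\<lambda>\<omega>. (norm (g \<omega>))\<^sup>2)"
    and "(\<integral>\<omega>. f (Y \<omega> - \<alpha> *\<^sub>R g \<omega>) \<partial>M)
      \<le> (\<integral>\<omega>. f (Y \<omega>) \<partial>M) - \<alpha> / 2 * (\<integral>\<omega>. (norm (gradf (Y \<omega>)))\<^sup>2 \<partial>M) + L\<^sub>g * \<sigma>\<^sup>2 / 2 * \<alpha>\<^sup>2"
proof -
  interpret prob_space M by fact
  interpret finite_measure_subalgebra M F by unfold_locales (rule sub)
  have Y [measurable]: "Y \<in> borel_measurable M" by (rule measurable_from_subalg[OF sub YF])
  note [measurable (raw)] = measurable_compose[OF _ borel_measurable_nth]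
  let ?G = "\<lambda>\<omega>. gradf (Y \<omega>)" and ?N = "\<lambda>\<omega>. g \<omega> - gradf (Y \<omega>)"
  have GF: "?G \<in> borel_measurable F" using YF by measurable
  have G2: "integrable M (\<lambda>\<omega>. (norm (?G \<omega>))\<^sup>2)"
    by (rule gradf_square_integrable[OF \<open>prob_space M\<close> Y Y2])
  have "integrable M (\<lambda>\<omega>. (norm (?G \<omega> + 1 *\<^sub>R ?N \<omega>))\<^sup>2)"
    by (rule square_integrable_add_scaleR) (use G2 N2 in auto)
  then show g2: "integrable M (\<lambda>\<omega>. (norm (g \<omega>))\<^sup>2)" by simp
  have Gg: "integrable M (\<lambda>\<omega>. ?G \<omega> \<bullet> g \<omega>)"
    by (rule inner_integrable_of_square_integrable) (use G2 g2 in auto)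
  have comp: "integrable M (\<lambda>\<omega>. ?G \<omega> $ i * Z \<omega> $ i)"
    if [measurable]: "Z \<in> borel_measurable M" and Z2: "integrable M (\<lambda>\<omega>. (norm (Z \<omega>))\<^sup>2)"
    for i and Z :: "'w \<Rightarrow> real^'n"
  proof (rule integrable_of_abs_le)
    show "integrable M (\<lambda>\<omega>. (norm (?G \<omega>))\<^sup>2 + (norm (Z \<omega>))\<^sup>2)" using G2 Z2 by simp
    fix \<omega>
    have "\<bar>?G \<omega> $ i * Z \<omega> $ i\<bar> \<le> norm (?G \<omega>) * norm (Z \<omega>)"
      unfolding abs_mult by (intro mult_mono component_le_norm_cart) auto
    moreover have "0 \<le> norm (?G \<omega>) * norm (Z \<omega>)" by simp
    moreover have "2 * norm (?G \<omega>) * norm (Z \<omega>) \<le> (norm (?G \<omega>))\<^sup>2 + (norm (Z \<omega>))\<^sup>2"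
      by (rule sum_squares_bound)
    ultimately show "\<bar>?G \<omega> $ i * Z \<omega> $ i\<bar> \<le> (norm (?G \<omega>))\<^sup>2 + (norm (Z \<omega>))\<^sup>2" by linarith
  qed measurable
  \<comment> \<open>Unbiasedness is a statement about coordinates, so the coordinates of \<open>\<nabla>f(Y)\<close>, which are
    measurable for \<open>F\<close>, serve as the weights.\<close>
  have coord: "(\<integral>\<omega>. ?G \<omega> $ i * g \<omega> $ i \<partial>M) = (\<integral>\<omega>. ?G \<omega> $ i * ?G \<omega> $ i \<partial>M)" for i
  proof -
    have "(\<integral>\<omega>. ?G \<omega> $ i * g \<omega> $ i \<partial>M)
        = (\<integral>\<omega>. ?G \<omega> $ i * real_cond_exp M F (\<lambda>\<omega>. g \<omega> $ i) \<omega> \<partial>M)"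
      by (rule real_cond_exp_intg(2)[symmetric]) (use comp[OF g g2] GF in measurable)
    also have "\<dots> = (\<integral>\<omega>. ?G \<omega> $ i * ?G \<omega> $ i \<partial>M)"
    proof (rule integral_cong_AE)
      show "AE \<omega> in M. ?G \<omega> $ i * real_cond_exp M F (\<lambda>\<omega>. g \<omega> $ i) \<omega> = ?G \<omega> $ i * ?G \<omega> $ i"
        using unbiased by eventually_elim (simp add: vec_cond_exp_def vec_eq_iff)
    qed measurable
    finally show ?thesis .
  qed
  let ?G2 = "\<integral>\<omega>. (norm (?G \<omega>))\<^sup>2 \<partial>M" and ?N2 = "\<integral>\<omega>. (norm (?N \<omega>))\<^sup>2 \<partial>M"
  have GG: "(\<integral>\<omega>. ?G \<omega> \<bullet> g \<omega> \<partial>M) = ?G2"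
  proof -
    have "(\<integral>\<omega>. ?G \<omega> \<bullet> g \<omega> \<partial>M) = (\<Sum>i\<in>UNIV. \<integral>\<omega>. ?G \<omega> $ i * g \<omega> $ i \<partial>M)"
      unfolding inner_vec_def inner_real_def
      by (rule Bochner_Integration.integral_sum) (rule comp[OF g g2])
    also have "\<dots> = (\<Sum>i\<in>UNIV. \<integral>\<omega>. ?G \<omega> $ i * ?G \<omega> $ i \<partial>M)" by (simp only: coord)
    also have "\<dots> = (\<integral>\<omega>. (\<Sum>i\<in>UNIV. ?G \<omega> $ i * ?G \<omega> $ i) \<partial>M)"
      by (rule Bochner_Integration.integral_sum[symmetric]) (rule comp[OF _ G2], measurable)
    finally show ?thesis by (simp add: power2_norm_eq_inner inner_vec_def)
  qed
  have N2le: "?N2 \<le> \<theta>\<^sup>2 * ?G2 + \<sigma>\<^sup>2"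
  proof -
    have "?N2 = (\<integral>\<omega>. real_cond_exp M F (\<lambda>\<omega>. (norm (?N \<omega>))\<^sup>2) \<omega> \<partial>M)"
      using real_cond_exp_int[OF N2] by simp
    also have "\<dots> \<le> (\<integral>\<omega>. \<theta>\<^sup>2 * (norm (?G \<omega>))\<^sup>2 + \<sigma>\<^sup>2 \<partial>M)"
      by (rule integral_mono_AE) (use real_cond_exp_int[OF N2] G2 var in auto)
    also have "\<dots> = \<theta>\<^sup>2 * ?G2 + \<sigma>\<^sup>2" using G2 by (simp add: prob_space)
    finally show ?thesis .
  qed
  have "(norm (g \<omega>))\<^sup>2 = (norm (?N \<omega>))\<^sup>2 - (norm (?G \<omega>))\<^sup>2 + 2 * (?G \<omega> \<bullet> g \<omega>)" for \<omega>
    by (simp add: power2_norm_eq_inner inner_diff_left inner_diff_right inner_commute)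
  then have g2eq: "(\<integral>\<omega>. (norm (g \<omega>))\<^sup>2 \<partial>M) = ?N2 + ?G2"
    using N2 G2 Gg by (simp add: GG)
  have "(\<integral>\<omega>. f (Y \<omega> - \<alpha> *\<^sub>R g \<omega>) \<partial>M)
      \<le> (\<integral>\<omega>. f (Y \<omega>) - \<alpha> * (?G \<omega> \<bullet> g \<omega>) + L\<^sub>g * \<alpha>\<^sup>2 / 2 * (norm (g \<omega>))\<^sup>2 \<partial>M)"
  proof (rule integral_mono)
    have "integrable M (\<lambda>\<omega>. (norm (Y \<omega> + (- \<alpha>) *\<^sub>R g \<omega>))\<^sup>2)"
      by (rule square_integrable_add_scaleR[OF Y g Y2 g2])
    then show "integrable M (\<lambda>\<omega>. f (Y \<omega> - \<alpha> *\<^sub>R g \<omega>))"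
      by (intro f_integrable[OF \<open>prob_space M\<close>]) auto
    show "f (Y \<omega> - \<alpha> *\<^sub>R g \<omega>)
        \<le> f (Y \<omega>) - \<alpha> * (?G \<omega> \<bullet> g \<omega>) + L\<^sub>g * \<alpha>\<^sup>2 / 2 * (norm (g \<omega>))\<^sup>2" for \<omega>
      using f_upper_quadratic[of "Y \<omega>" "(- \<alpha>) *\<^sub>R g \<omega>"] by (simp add: power_mult_distrib)
  qed (use f_integrable[OF \<open>prob_space M\<close> Y Y2] Gg g2 in auto)
  also have "\<dots> = (\<integral>\<omega>. f (Y \<omega>) \<partial>M) - \<alpha> * ?G2 + L\<^sub>g * \<alpha>\<^sup>2 / 2 * (?N2 + ?G2)"
    using f_integrable[OF \<open>prob_space M\<close> Y Y2] Gg g2 by (simp add: GG g2eq)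
  also have "\<dots> \<le> (\<integral>\<omega>. f (Y \<omega>) \<partial>M) - \<alpha> * ?G2 + L\<^sub>g * \<alpha>\<^sup>2 / 2 * ((\<theta>\<^sup>2 * ?G2 + \<sigma>\<^sup>2) + ?G2)"
    using N2le L_pos by (intro add_left_mono mult_left_mono add_right_mono) auto
  also have "\<dots> = (\<integral>\<omega>. f (Y \<omega>) \<partial>M) - \<alpha> * ?G2 + L\<^sub>g * \<sigma>\<^sup>2 / 2 * \<alpha>\<^sup>2
      + \<alpha> / 2 * (\<alpha> * (L\<^sub>g * (1 + \<theta>\<^sup>2))) * ?G2"
    by (simp add: power2_eq_square field_simps)
  also have "\<dots> \<le> (\<integral>\<omega>. f (Y \<omega>) \<partial>M) - \<alpha> * ?G2 + L\<^sub>g * \<sigma>\<^sup>2 / 2 * \<alpha>\<^sup>2 + \<alpha> / 2 * 1 * ?G2"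
  proof -
    have "0 < L\<^sub>g * (1 + \<theta>\<^sup>2)" using L_pos by (simp add: add_pos_nonneg)
    then have "\<alpha> * (L\<^sub>g * (1 + \<theta>\<^sup>2)) \<le> 1"
      using \<alpha>(2) by (simp only: pos_le_divide_eq)
    then show ?thesis
      using \<alpha>(1) by (intro add_left_mono mult_right_mono mult_left_mono) auto
  qed
  finally show "(\<integral>\<omega>. f (Y \<omega> - \<alpha> *\<^sub>R g \<omega>) \<partial>M)
      \<le> (\<integral>\<omega>. f (Y \<omega>) \<partial>M) - \<alpha> / 2 * (\<integral>\<omega>. (norm (gradf (Y \<omega>)))\<^sup>2 \<partial>M) + L\<^sub>g * \<sigma>\<^sup>2 / 2 * \<alpha>\<^sup>2"
    by (simp add: algebra_simps)
qed

end

section \<open>Convergence\<close>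

text \<open>If the \<open>E k\<close> stayed above some \<open>c > 0\<close>, then eventually \<open>a k \<ge> (c / 2)\<^sup>2\<close>, and the divergence of
  \<open>\<Sum> \<alpha>\<close> would contradict the bound \<open>B\<close>.\<close>

lemma liminf_zero_of_weighted_sum_bounded:
  fixes \<alpha> a b E :: "nat \<Rightarrow> real"
  assumes \<alpha>: "\<And>k. 0 < \<alpha> k" "filterlim (\<lambda>n. \<Sum>k<n. \<alpha> k) at_top sequentially"
    and a: "\<And>k. 0 \<le> a k" "\<And>n. (\<Sum>k<n. \<alpha> k * a k) \<le> B"
    and b: "b \<longlonglongrightarrow> 0"
    and E: "\<And>k. 0 \<le> E k" "\<And>k. E k \<le> sqrt (a k) + b k"
  shows "liminf (\<lambda>k. ereal (E k)) = 0"
proof (rule antisym)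
  show "0 \<le> liminf (\<lambda>k. ereal (E k))"
    by (rule Liminf_bounded) (simp add: E)
  show "liminf (\<lambda>k. ereal (E k)) \<le> 0"
  proof (rule ccontr)
    assume "\<not> ?thesis"
    then obtain c where c: "0 < ereal c" "ereal c < liminf (\<lambda>k. ereal (E k))"
      using ereal_dense2[of 0 "liminf (\<lambda>k. ereal (E k))"] unfolding not_le zero_ereal_def
      by blast
    have "\<forall>\<^sub>F k in sequentially. c < E k"
      using less_LiminfD[OF c(2)] by simp
    moreover have "\<forall>\<^sub>F k in sequentially. b k < c / 2"
      using c by (intro order_tendstoD(2)[OF b]) simp
    ultimately have "\<forall>\<^sub>F k in sequentially. (c / 2)\<^sup>2 \<le> a k"
    proof eventually_elim
      case (elim k)
      then have "c / 2 \<le> sqrt (a k)" using E(2)[of k] by linarith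
      then have "(c / 2)\<^sup>2 \<le> (sqrt (a k))\<^sup>2" using c by (intro power_mono) auto
      then show ?case using a(1) by simp
    qed
    then obtain N where N: "\<And>k. N \<le> k \<Longrightarrow> (c / 2)\<^sup>2 \<le> a k"
      by (auto simp: eventually_sequentially)
    define d where "d = (c / 2)\<^sup>2"
    have d: "0 < d" using c by (simp add: d_def)
    have ge: "d * ((\<Sum>k<n. \<alpha> k) - (\<Sum>k<N. \<alpha> k)) \<le> (\<Sum>k<n. \<alpha> k * a k)" for n
    proof -
      have "(\<Sum>k<n. \<alpha> k) \<le> (\<Sum>k\<in>{..<N} \<union> {N..<n}. \<alpha> k)"
        using less_imp_le[OF \<alpha>(1)] by (intro sum_mono2) auto
      also have "\<dots> = (\<Sum>k<N. \<alpha> k) + (\<Sum>k\<in>{N..<n}. \<alpha> k)"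
        by (rule sum.union_disjoint) auto
      finally have "d * ((\<Sum>k<n. \<alpha> k) - (\<Sum>k<N. \<alpha> k)) \<le> d * (\<Sum>k\<in>{N..<n}. \<alpha> k)"
        using d by (intro mult_left_mono) auto
      also have "\<dots> = (\<Sum>k\<in>{N..<n}. \<alpha> k * d)" by (simp add: sum_distrib_left mult.commute)
      also have "\<dots> \<le> (\<Sum>k\<in>{N..<n}. \<alpha> k * a k)"
        using N less_imp_le[OF \<alpha>(1)] by (intro sum_mono mult_left_mono) (auto simp: d_def)
      also have "\<dots> \<le> (\<Sum>k<n. \<alpha> k * a k)"
        using less_imp_le[OF \<alpha>(1)] a(1) by (intro sum_mono2) auto
      finally show ?thesis .
    qed
    have "\<forall>\<^sub>F n in sequentially. B / d + (\<Sum>k<N. \<alpha> k) + 1 \<le> (\<Sum>k<n. \<alpha> k)"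
      using \<alpha>(2) by (simp add: filterlim_at_top)
    then obtain n where "B / d + (\<Sum>k<N. \<alpha> k) + 1 \<le> (\<Sum>k<n. \<alpha> k)"
      using eventually_happens'[OF sequentially_bot] by blast
    then have n: "B / d + 1 \<le> (\<Sum>k<n. \<alpha> k) - (\<Sum>k<N. \<alpha> k)"
      by argo
    have "d * (B / d + 1) \<le> B"
      using mult_left_mono[OF n less_imp_le[OF d]] ge[of n] a(2)[of n] by linarith
    then show False using d by (simp add: distrib_left)
  qed
qed

theorem theorem3p10:
  fixes M :: "'w measure"
    and f :: "real^'n \<Rightarrow> real"
    and gradf :: "real^'n \<Rightarrow> real^'n"
    and hessf :: "real^'n \<Rightarrow> real^'n^'n"
    and fbar L\<^sub>g L\<^sub>H \<gamma> \<gamma>\<^sub>H \<gamma>\<^sub>l \<delta> \<sigma> \<sigma>hat :: real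
    and \<alpha> \<beta> \<theta> \<theta>hat :: "nat \<Rightarrow> real"
    and x0 :: "real^'n"
    and x xhat p q g ghat :: "nat \<Rightarrow> 'w \<Rightarrow> real^'n"
    and H :: "nat \<Rightarrow> 'w \<Rightarrow> real^'n^'n"
  assumes "prob_space M"
    and grad: "\<And>y. GDERIV f y :> gradf y"
    and hess: "\<And>y. (gradf has_derivative (\<lambda>h. hessf y *v h)) (at y)"
    and hess_cont: "continuous_on UNIV hessf"
    and L_pos: "L\<^sub>g > 0" "L\<^sub>H > 0"
    and grad_lipschitz: "\<And>y z. norm (gradf y - gradf z) \<le> L\<^sub>g * norm (y - z)"
    and hess_lipschitz: "\<And>y z. onorm (\<lambda>v. (hessf y - hessf z) *v v) \<le> L\<^sub>H * norm (y - z)"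
    and bounded_below: "\<And>y. fbar \<le> f y"
    and "0 < \<gamma>" "\<gamma> \<le> 1"
    and "0 \<le> \<gamma>\<^sub>H" "\<gamma>\<^sub>H < \<gamma>"
    and "0 \<le> \<gamma>\<^sub>l" "\<gamma>\<^sub>l < 1"
    and "\<gamma>\<^sub>H < \<gamma> * (1 - \<gamma>\<^sub>l)"
    and "0 < \<delta>"
    and "\<And>k. 0 \<le> \<theta> k" "\<And>k. \<theta> k < 1"
    and "\<And>k. 0 \<le> \<theta>hat k"
    and "0 \<le> \<sigma>" "0 < \<sigma>hat"
    and run: "two_step_method M x0 \<alpha> \<beta> H p ghat x xhat"
    and A: "condition_A M gradf \<gamma> \<delta> \<theta> (\<lambda>_. \<sigma>) x H g q p"
    and B: "condition_B M hessf \<gamma>\<^sub>H \<gamma>\<^sub>l x H p"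
    and C: "condition_C M gradf \<theta>hat (\<lambda>_. \<sigma>hat) x xhat ghat"
    and alpha: "\<And>k. 0 < \<alpha> k" "\<And>k. \<alpha> k \<le> 1 / (L\<^sub>g * (1 + (\<theta>hat k)\<^sup>2))"
    and beta: "\<And>k. 0 < \<beta> k" "\<And>k. \<beta> k \<le> 3 * (\<gamma> - \<gamma>\<^sub>H / (1 - \<gamma>\<^sub>l)) / (2 * \<delta> * L\<^sub>H)"
    and alpha_sum: "filterlim (\<lambda>n. \<Sum>k<n. \<alpha> k) at_top sequentially"
    and alpha_sq_sum: "summable (\<lambda>k. (\<alpha> k)\<^sup>2)"
    and beta_sum: "summable \<beta>"
  shows "(\<forall>k. integrable M (\<lambda>\<omega>. norm (gradf (x k \<omega>)))) \<and>
    liminf (\<lambda>k. ereal (\<integral>\<omega>. norm (gradf (x k \<omega>)) \<partial>M)) = 0"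
proof -
  interpret prob_space M by fact
  interpret smooth_objective f gradf hessf L\<^sub>g L\<^sub>H fbar
    by unfold_locales (fact grad hess hess_cont L_pos grad_lipschitz hess_lipschitz bounded_below)+
  have meas [measurable]: "p k \<in> borel_measurable M" "ghat k \<in> borel_measurable M" for k
    using run by (auto simp: two_step_method_def)
  have x0: "x 0 \<omega> = x0" and xhat: "xhat k \<omega> = x k \<omega> + \<beta> k *\<^sub>R p k \<omega>"
    and x_Suc: "x (Suc k) \<omega> = xhat k \<omega> - \<alpha> k *\<^sub>R ghat k \<omega>" if "\<omega> \<in> space M" for k \<omega>
    using run that by (auto simp: two_step_method_def)
  have x_meas [measurable]: "x k \<in> borel_measurable M" for k
  proof (induction k)
    case 0
    show ?case by (subst measurable_cong[OF x0]) auto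
  next
    case (Suc k)
    note [measurable] = Suc
    have "x (Suc k) \<omega> = (x k \<omega> + \<beta> k *\<^sub>R p k \<omega>) - \<alpha> k *\<^sub>R ghat k \<omega>" if "\<omega> \<in> space M" for \<omega>
      using x_Suc[OF that] xhat[OF that] by simp
    then show ?case by (subst measurable_cong) (assumption, measurable)
  qed
  have xhat_meas [measurable]: "xhat k \<in> borel_measurable M" for k
    by (subst measurable_cong[OF xhat]) measurable
  have sub: "subalgebra M (hist M x k)" for k
    unfolding hist_def by (rule subalgebra_generated_sigma) auto
  have sub_with: "subalgebra M (hist_with M x k Z)" if "Z \<in> borel_measurable M" for k Z
    unfolding hist_with_def by (rule subalgebra_generated_sigma) (use that in auto)
  have x_hist: "x k \<in> borel_measurable (hist M x k)" for k
    unfolding hist_def by (rule generated_sigma_measurable) auto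
  have xhat_hist: "xhat k \<in> borel_measurable (hist_with M x k (xhat k))" for k
    unfolding hist_with_def by (rule generated_sigma_measurable) auto

  have q_meas: "q k \<in> borel_measurable M" for k
    using A by (auto simp: condition_A_def)
  have p_cases: "if lambda_min (H k \<omega>) \<ge> 0 then p k \<omega> = 0 \<and> q k \<omega> = 0
      else p k \<omega> = (if g k \<omega> \<bullet> q k \<omega> \<le> 0 then q k \<omega> else - q k \<omega>) \<and>
           q k \<omega> \<bullet> (H k \<omega> *v q k \<omega>) \<le> \<gamma> * lambda_min (H k \<omega>) * (norm (q k \<omega>))\<^sup>2 \<and>
           \<gamma> * lambda_min (H k \<omega>) * (norm (q k \<omega>))\<^sup>2 < 0 \<and>
           norm (q k \<omega>) = \<delta> * \<bar>lambda_min (H k \<omega>)\<bar>" if "\<omega> \<in> space M" for k \<omega>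
    using A that unfolding condition_A_def by blast
  \<comment> \<open>If the estimated Hessian has no negative eigenvalue, then \<open>q\<close> and \<open>p\<close> vanish and the sign rule
    holds trivially.\<close>
  have p_sign: "p k \<omega> = (if g k \<omega> \<bullet> q k \<omega> \<le> 0 then q k \<omega> else - q k \<omega>)"
    if "\<omega> \<in> space M" for k \<omega>
    using p_cases[OF that, of k] by (auto split: if_splits)
  have norm_p: "norm (p k \<omega>) = \<delta> * \<bar>lambda_min_neg (H k \<omega>)\<bar>" if "\<omega> \<in> space M" for k \<omega>
    using p_cases[OF that, of k] by (auto simp: lambda_min_neg_def min_def split: if_splits)
  have curv: "p k \<omega> \<bullet> (H k \<omega> *v p k \<omega>) \<le> \<gamma> * lambda_min_neg (H k \<omega>) * (norm (p k \<omega>))\<^sup>2"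
    if "\<omega> \<in> space M" for k \<omega>
  proof -
    have "H k \<omega> *v (- q k \<omega>) = - (H k \<omega> *v q k \<omega>)"
      using matrix_vector_mult_scaleR[of "H k \<omega>" "- 1" "q k \<omega>"] by simp
    then show ?thesis
      using p_cases[OF that, of k] by (auto simp: lambda_min_neg_def min_def split: if_splits)
  qed
  have slope: "integrable M (\<lambda>\<omega>. gradf (x k \<omega>) \<bullet> p k \<omega>)"
    "(\<integral>\<omega>. gradf (x k \<omega>) \<bullet> p k \<omega> \<partial>M) \<le> \<sigma>\<^sup>2" for k
  proof -
    note A_k = A[unfolded condition_A_def, THEN spec, of k]
    have \<theta>1: "\<theta> k \<le> 1" using \<open>\<And>k. \<theta> k < 1\<close> by (rule less_imp_le)
    note * = integral_gradient_times_step_le[where G = "\<lambda>\<omega>. gradf (x k \<omega>)" and p = "p k"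
        and g = "g k" and q = "q k" and \<theta> = "\<theta> k" and \<sigma> = \<sigma>, OF sub_with[OF q_meas, of k k]]
    show "integrable M (\<lambda>\<omega>. gradf (x k \<omega>) \<bullet> p k \<omega>)"
      by (rule *(1)) (use A_k p_sign \<theta>1 \<open>\<And>k. 0 \<le> \<theta> k\<close> in \<open>auto intro: measurable_compose[OF x_meas gradf_borel]\<close>)
    show "(\<integral>\<omega>. gradf (x k \<omega>) \<bullet> p k \<omega> \<partial>M) \<le> \<sigma>\<^sup>2"
      by (rule *(2)) (use A_k p_sign \<theta>1 \<open>\<And>k. 0 \<le> \<theta> k\<close> in \<open>auto intro: measurable_compose[OF x_meas gradf_borel]\<close>)
  qed
  note B_k = B[unfolded condition_B_def, THEN spec]
  have p2: "integrable M (\<lambda>\<omega>. (norm (p k \<omega>))\<^sup>2)" for k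
    using B_k[of k] by blast

  note C_k = C[unfolded condition_C_def, THEN spec]
  note grad_step = gradient_step_decrease[OF \<open>prob_space M\<close> sub_with[OF xhat_meas] xhat_hist meas(2)]
  have xhat2_of_x2: "integrable M (\<lambda>\<omega>. (norm (xhat k \<omega>))\<^sup>2)"
    if "integrable M (\<lambda>\<omega>. (norm (x k \<omega>))\<^sup>2)" for k
  proof -
    have "integrable M (\<lambda>\<omega>. (norm (x k \<omega> + \<beta> k *\<^sub>R p k \<omega>))\<^sup>2)"
      by (rule square_integrable_add_scaleR[OF x_meas meas(1) that p2])
    then show ?thesis
      by (subst Bochner_Integration.integrable_cong[OF refl, of M _ "\<lambda>\<omega>. (norm (x k \<omega> + \<beta> k *\<^sub>R p k \<omega>))\<^sup>2"])
         (simp_all add: xhat)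
  qed
  have ghat2_of_xhat2: "integrable M (\<lambda>\<omega>. (norm (ghat k \<omega>))\<^sup>2)"
    if "integrable M (\<lambda>\<omega>. (norm (xhat k \<omega>))\<^sup>2)" for k
    using C_k[of k] by (intro grad_step(1)[OF that _ _ _ alpha]) auto
  \<comment> \<open>All iterates are square integrable: \<open>p\<close> and the noise of \<open>ghat\<close> are so by assumption, and the
    Lipschitz gradient inherits it from its argument. Hence all values of \<open>f\<close> are integrable.\<close>
  have x2: "integrable M (\<lambda>\<omega>. (norm (x k \<omega>))\<^sup>2)" for k
  proof (induction k)
    case 0
    show ?case
      by (subst Bochner_Integration.integrable_cong[OF refl, of M _ "\<lambda>\<omega>. (norm x0)\<^sup>2"]) (simp_all add: x0)
  next
    case (Suc k)
    note h = xhat2_of_x2[OF Suc]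
    have "integrable M (\<lambda>\<omega>. (norm (xhat k \<omega> + (- \<alpha> k) *\<^sub>R ghat k \<omega>))\<^sup>2)"
      by (rule square_integrable_add_scaleR[OF xhat_meas meas(2) h ghat2_of_xhat2[OF h]])
    then show ?case
      by (subst Bochner_Integration.integrable_cong[OF refl,
            of M _ "\<lambda>\<omega>. (norm (xhat k \<omega> + (- \<alpha> k) *\<^sub>R ghat k \<omega>))\<^sup>2"]) (simp_all add: x_Suc)
  qed
  note xhat2 = xhat2_of_x2[OF x2]

  have curv_step: "(\<integral>\<omega>. f (x k \<omega> + \<beta> k *\<^sub>R p k \<omega>) \<partial>M) \<le> (\<integral>\<omega>. f (x k \<omega>) \<partial>M) + \<beta> k * \<sigma>\<^sup>2"
    "(\<integral>\<omega>. norm (p k \<omega>) \<partial>M) \<le> \<delta> * ((1 + \<gamma>\<^sub>l) * L\<^sub>g)" for k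
  proof -
    note B' = B_k[of k, THEN conjunct1] B_k[of k, THEN conjunct2, THEN conjunct1]
      B_k[of k, THEN conjunct2, THEN conjunct2, THEN conjunct1]
      B_k[of k, THEN conjunct2, THEN conjunct2, THEN conjunct2, THEN conjunct1]
      B_k[of k, THEN conjunct2, THEN conjunct2, THEN conjunct2, THEN conjunct2]
    note * = curvature_step_decrease[where p = "p k" and X = "x k" and H = "H k" and \<gamma> = \<gamma>,
        OF \<open>prob_space M\<close> sub x_hist meas(1) x2 \<open>0 < \<gamma>\<close> \<open>0 \<le> \<gamma>\<^sub>H\<close> \<open>0 \<le> \<gamma>\<^sub>l\<close> \<open>\<gamma>\<^sub>l < 1\<close>
          \<open>0 < \<delta>\<close> beta norm_p curv slope B']
    show "(\<integral>\<omega>. f (x k \<omega> + \<beta> k *\<^sub>R p k \<omega>) \<partial>M) \<le> (\<integral>\<omega>. f (x k \<omega>) \<partial>M) + \<beta> k * \<sigma>\<^sup>2"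
      by (rule *)
    show "(\<integral>\<omega>. norm (p k \<omega>) \<partial>M) \<le> \<delta> * ((1 + \<gamma>\<^sub>l) * L\<^sub>g)"
      by (rule *)
  qed
  define Ef where "Ef k = (\<integral>\<omega>. f (x k \<omega>) \<partial>M)" for k
  define a where "a k = (\<integral>\<omega>. (norm (gradf (xhat k \<omega>)))\<^sup>2 \<partial>M)" for k
  have a0: "0 \<le> a k" for k by (simp add: a_def)
  have step: "Ef (Suc k) \<le> Ef k + \<beta> k * \<sigma>\<^sup>2 - \<alpha> k / 2 * a k + L\<^sub>g * \<sigma>hat\<^sup>2 / 2 * (\<alpha> k)\<^sup>2" for k
  proof -
    have "Ef (Suc k) = (\<integral>\<omega>. f (xhat k \<omega> - \<alpha> k *\<^sub>R ghat k \<omega>) \<partial>M)"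
      unfolding Ef_def by (rule Bochner_Integration.integral_cong) (simp_all add: x_Suc)
    also have "\<dots> \<le> (\<integral>\<omega>. f (xhat k \<omega>) \<partial>M) - \<alpha> k / 2 * a k + L\<^sub>g * \<sigma>hat\<^sup>2 / 2 * (\<alpha> k)\<^sup>2"
      unfolding a_def using C_k[of k] by (intro grad_step(2)[OF xhat2 _ _ _ alpha]) auto
    also have "(\<integral>\<omega>. f (xhat k \<omega>) \<partial>M) = (\<integral>\<omega>. f (x k \<omega> + \<beta> k *\<^sub>R p k \<omega>) \<partial>M)"
      by (rule Bochner_Integration.integral_cong) (simp_all add: xhat)
    finally show ?thesis using curv_step(1)[of k] by (simp add: Ef_def)
  qed
  have telescope: "Ef n + (\<Sum>k<n. \<alpha> k * a k) / 2
      \<le> Ef 0 + \<sigma>\<^sup>2 * (\<Sum>k<n. \<beta> k) + L\<^sub>g * \<sigma>hat\<^sup>2 / 2 * (\<Sum>k<n. (\<alpha> k)\<^sup>2)" for n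
  proof (induction n)
    case (Suc n)
    then show ?case using step[of n] by (simp add: algebra_simps add_divide_distrib)
  qed simp
  have f_ge: "fbar \<le> Ef n" for n
    unfolding Ef_def
    by (rule integral_ge_const) (use f_integrable[OF \<open>prob_space M\<close> x_meas x2] bounded_below in auto)
  have \<beta>_le: "\<sigma>\<^sup>2 * (\<Sum>k<n. \<beta> k) \<le> \<sigma>\<^sup>2 * suminf \<beta>" for n
    using beta(1) by (intro mult_left_mono sum_le_suminf[OF beta_sum]) (auto intro: less_imp_le)
  have \<alpha>_le: "L\<^sub>g * \<sigma>hat\<^sup>2 / 2 * (\<Sum>k<n. (\<alpha> k)\<^sup>2) \<le> L\<^sub>g * \<sigma>hat\<^sup>2 / 2 * (\<Sum>k. (\<alpha> k)\<^sup>2)" for n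
    using L_pos(1) by (intro mult_left_mono sum_le_suminf[OF alpha_sq_sum]) auto
  have sum_bounded: "(\<Sum>k<n. \<alpha> k * a k) \<le>
      2 * (Ef 0 + \<sigma>\<^sup>2 * suminf \<beta> + L\<^sub>g * \<sigma>hat\<^sup>2 / 2 * (\<Sum>k. (\<alpha> k)\<^sup>2) - fbar)" for n
  proof -
    have "S \<le> 2 * (e + u' + v' - l)" if "E + S / 2 \<le> e + u + v" "l \<le> E" "u \<le> u'" "v \<le> v'"
      for S e u u' v v' l E :: real
      using that by argo
    from this[OF telescope[of n] f_ge[of n] \<beta>_le[of n] \<alpha>_le[of n]] show ?thesis .
  qed

  have grad_int: "integrable M (\<lambda>\<omega>. norm (gradf (x k \<omega>)))" for k
    by (rule integrable_of_square_integrable)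
       (use gradf_square_integrable[OF \<open>prob_space M\<close> x_meas x2] in measurable)
  have transfer: "(\<integral>\<omega>. norm (gradf (x k \<omega>)) \<partial>M) \<le> sqrt (a k) + L\<^sub>g * \<delta> * ((1 + \<gamma>\<^sub>l) * L\<^sub>g) * \<beta> k" for k
  proof -
    let ?h = "\<lambda>\<omega>. norm (gradf (xhat k \<omega>))"
    have h2: "integrable M (\<lambda>\<omega>. (?h \<omega>)\<^sup>2)"
      by (rule gradf_square_integrable[OF \<open>prob_space M\<close> xhat_meas xhat2])
    have h: "integrable M ?h"
      by (rule integrable_of_square_integrable) (use h2 in measurable)
    have pint: "integrable M (\<lambda>\<omega>. norm (p k \<omega>))"
      by (rule integrable_of_square_integrable[OF meas(1) p2])
    \<comment> \<open>A variance is nonnegative.\<close>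
    have "(\<integral>\<omega>. ?h \<omega> \<partial>M)\<^sup>2 \<le> a k"
      using variance_eq[OF h h2] variance_positive[of ?h] unfolding a_def by simp
    then have "(\<integral>\<omega>. ?h \<omega> \<partial>M) \<le> sqrt (a k)"
      by (rule real_le_rsqrt)
    moreover have "(\<integral>\<omega>. norm (gradf (x k \<omega>)) \<partial>M) \<le> (\<integral>\<omega>. ?h \<omega> + L\<^sub>g * \<beta> k * norm (p k \<omega>) \<partial>M)"
    proof (rule integral_mono[OF grad_int])
      fix \<omega> assume \<omega>: "\<omega> \<in> space M"
      have "norm (gradf (x k \<omega>)) \<le> ?h \<omega> + norm (gradf (x k \<omega>) - gradf (xhat k \<omega>))"
        by (rule norm_triangle_sub)
      also have "norm (gradf (x k \<omega>) - gradf (xhat k \<omega>)) \<le> L\<^sub>g * norm (x k \<omega> - xhat k \<omega>)"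
        by (rule grad_lipschitz)
      finally show "norm (gradf (x k \<omega>)) \<le> ?h \<omega> + L\<^sub>g * \<beta> k * norm (p k \<omega>)"
        using beta(1)[of k] by (simp add: xhat[OF \<omega>])
    qed (use h pint in simp)
    moreover have "\<dots> = (\<integral>\<omega>. ?h \<omega> \<partial>M) + L\<^sub>g * \<beta> k * (\<integral>\<omega>. norm (p k \<omega>) \<partial>M)"
      using h pint by simp
    moreover have "L\<^sub>g * \<beta> k * (\<integral>\<omega>. norm (p k \<omega>) \<partial>M) \<le> L\<^sub>g * \<beta> k * (\<delta> * ((1 + \<gamma>\<^sub>l) * L\<^sub>g))"
      using L_pos(1) beta(1)[of k] by (intro mult_left_mono[OF curv_step(2)]) simp
    ultimately show ?thesis by (simp add: mult.commute mult.left_commute)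
  qed
  have "(\<lambda>k. L\<^sub>g * \<delta> * ((1 + \<gamma>\<^sub>l) * L\<^sub>g) * \<beta> k) \<longlonglongrightarrow> 0"
    using tendsto_mult_right_zero[OF summable_LIMSEQ_zero[OF beta_sum]] .
  then have "liminf (\<lambda>k. ereal (\<integral>\<omega>. norm (gradf (x k \<omega>)) \<partial>M)) = 0"
    by (rule liminf_zero_of_weighted_sum_bounded[OF alpha(1) alpha_sum a0 sum_bounded _ _ transfer]) simp
  with grad_int show ?thesis by blast
qed

end
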